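(* Let $h_1,l_1,l_2,\alpha_1,\lambda\in\mathbb{C}$ and $t_1,t_2\in\mathbb{C}\setminus\{0\}$. Consider the $q$-difference equation (variant of the confluent $q$-hypergeometric equation of type $(2,1)$) $$(x-q^{l_1-1/2}t_1)(x-q^{l_2-1/2}t_2)g(qx)-q^{-h_1+l_1+l_2+2\lambda-1/2}t_2(x-q^{h_1+1/2}t_1)g(x/q)$$ $$-\big[q^{-\alpha_1}x^2-q^{l_1+l_2+\lambda-1/2}\{q^{-l_2}t_1+(q^{-h_1}+q^{-l_1})t_2\}x+q^{l_1+l_2+\lambda}(1+q^{-1})t_1t_2\big]g(x)=0.$$ Each of the following is a formal solution of this equation. (i) $$g(x)=x^\lambda\sum_{n=0}^\infty\Big(\frac{q^{h_1+1/2}t_1}{x};q\Big)_n\frac{(q^{\lambda+\alpha_1};q)_n\,q^{n(n-1)/2}(-q^{-\lambda-\alpha_1-l_1-l_2+h_1+3/2}x/t_2)^n}{(q^{h_1-l_1+1};q)_n(q^{h_1-l_2+1}t_1/t_2;q)_n(q;q)_n}$$ $$\Big(=x^\lambda\,{}_2\phi_2\Big(q^{\lambda+\alpha_1},\frac{q^{h_1+1/2}t_1}{x};q^{h_1-l_1+1},q^{h_1-l_2+1}t_1/t_2;q,q^{-\lambda-\alpha_1-l_1-l_2+h_1+3/2}x/t_2\Big)\Big).$$ (ii) $$g(x)=x^{-\alpha_1}\sum_{n=0}^\infty c_n\Big(\frac{x}{q^{l_1-1/2}t_1};q\Big)_n\Big(-\frac{q^{-\lambda-\alpha_1+l_1}t_1}{x}\Big)^n(q^{\lambda+\alpha_1};q)_n\,q^{-n^2/2},$$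 $$c_n=\sum_{k=0}^nq^{-nk+k^2/2}\frac{1}{(q^{h_1-l_1+1};q)_k(q;q)_{n-k}(q;q)_k}\Big(-\frac{q^{-\lambda-\alpha_1+h_1+1/2}t_1}{q^{l_2}t_2}\Big)^k.$$ (iii) $$g(x)=x^{-\alpha_1}\sum_{n=0}^\infty c_n\Big(\frac{x}{q^{l_2-1/2}t_2};q\Big)_n\Big(\frac{q^{-\lambda-\alpha_1+h_1+1/2}t_1}{x}\Big)^n\frac{(q^{\lambda+\alpha_1};q)_n}{(q^{1+h_1-l_2}t_1/t_2;q)_n},$$ $$c_n=\sum_{k=0}^nq^{-nk}\frac{(q^{\lambda+\alpha_1-h_1+l_1};q)_k}{(q;q)_{n-k}(q;q)_k}\Big(\frac{q^{-\lambda-\alpha_1+l_2}t_2}{q^{l_1}t_1}\Big)^k.$$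
   Context: Conventions: $q\in\mathbb{C}\setminus\{0\}$ is not a root of unity, with a fixed choice of $\log q$, and $q^{a}=\exp(a\log q)$. $(\lambda;q)_n=\prod_{j=0}^{n-1}(1-\lambda q^j)$. The basic hypergeometric series is ${}_r\phi_s(a_1,\dots,a_r;b_1,\dots,b_s;q,z)=\sum_{n\ge0}\frac{(a_1;q)_n\cdots(a_r;q)_n}{(b_1;q)_n\cdots(b_s;q)_n(q;q)_n}\big[(-1)^nq^{n(n-1)/2}\big]^{1+s-r}z^n$. Parameters are assumed such that no denominator factor in the displayed series vanishes. Formal solutions: convergence is not considered. For $\mu\in\mathbb{C}$, $x^\mu$ is a symbol with $(q^{\pm1}x)^\mu=q^{\pm\mu}x^\mu$. Each series has the form $x^\mu\sum_{n\ge0}a_n\varphi_n(x)$, where $a_n$ does not depend on $x$ and $\varphi_n$ (the $x$-dependent part of the $n$-th term) is a polynomial of degree $n$ in $x$ or a polynomial of degree $n$ in $1/x$ (here $\varphi_n=(q^{h_1+1/2}t_1/x;q)_n\,x^n$ in (i), $(x/(q^{l_1-1/2}t_1);q)_n\,x^{-n}$ in (ii), $(x/(q^{l_2-1/2}t_2);q)_n\,x^{-n}$ in (iii)). It is a formal solution if, substituting termwise into the left-hand side, dividing by $x^\mu$ (and also by $x^2$ when the $\varphi_n$ are polynomials in $1/x$), and expanding each resulting term in the basis $(\varphi_m)_{m\ge0}$, the total coefficient of every $\varphi_m$ (a finite sum) is zero. If the series terminates this means it is an exact solution. *)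

theory Defs
  imports Complex_Main "HOL-Computational_Algebra.Polynomial"
begin

text \<open>
  The complex number \<open>lq\<close> is the chosen value of \<open>log q\<close>, so \<open>q = exp lq\<close>.
\<close>

definition qpow :: "complex \<Rightarrow> complex \<Rightarrow> complex" where
  "qpow lq a = exp (a * lq)"

definition qpoch :: "complex \<Rightarrow> complex \<Rightarrow> nat \<Rightarrow> complex" where
  "qpoch a q n = (\<Prod>j<n. 1 - a * q ^ j)"

text \<open>The \<open>n\<close>-th term of the basic hypergeometric series \<open>\<^sub>r\<phi>\<^sub>s(as; bs; q, z)\<close>.\<close>

definition basic_hypergeom_term ::
    "complex list \<Rightarrow> complex list \<Rightarrow> complex \<Rightarrow> complex \<Rightarrow> nat \<Rightarrow> complex" where
  "basic_hypergeom_term as bs q z n =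
     (\<Prod>a\<leftarrow>as. qpoch a q n) / ((\<Prod>b\<leftarrow>bs. qpoch b q n) * qpoch q q n)
     * ((-1) ^ n * q ^ (n * (n - 1) div 2)) powi (1 + int (length bs) - int (length as)) * z ^ n"

text \<open>Left-hand side of the variant of the confluent \<open>q\<close>-hypergeometric equation of type (2,1).\<close>

definition vconf_lhs ::
    "complex \<Rightarrow> complex \<Rightarrow> complex \<Rightarrow> complex \<Rightarrow> complex \<Rightarrow> complex \<Rightarrow> complex \<Rightarrow> complex \<Rightarrow>
     (complex \<Rightarrow> complex) \<Rightarrow> complex \<Rightarrow> complex" where
  "vconf_lhs lq h1 l1 l2 \<alpha>1 lam t1 t2 g x =
     (let q = exp lq in
       (x - qpow lq (l1 - 1/2) * t1) * (x - qpow lq (l2 - 1/2) * t2) * g (q * x)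
       - qpow lq (- h1 + l1 + l2 + 2 * lam - 1/2) * t2 * (x - qpow lq (h1 + 1/2) * t1) * g (x / q)
       - (qpow lq (- \<alpha>1) * x ^ 2
          - qpow lq (l1 + l2 + lam - 1/2)
              * (qpow lq (- l2) * t1 + (qpow lq (- h1) + qpow lq (- l1)) * t2) * x
          + qpow lq (l1 + l2 + lam) * (1 + inverse q) * t1 * t2) * g x)"

text \<open>
  The symbol \<open>x\<^sup>\<mu>\<close> is rendered by an arbitrary function on the nonzero complex numbers obeying
  the rules by which the symbol is manipulated; see lemma \<open>xpow_symbol_exists\<close> below.
\<close>

definition xpow_symbol :: "complex \<Rightarrow> complex \<Rightarrow> (complex \<Rightarrow> complex) \<Rightarrow> bool" where
  "xpow_symbol lq \<mu> X \<longleftrightarrow>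
     (\<forall>x. x \<noteq> 0 \<longrightarrow> X x \<noteq> 0 \<and> X (exp lq * x) = qpow lq \<mu> * X x
                         \<and> X (x / exp lq) = qpow lq (- \<mu>) * X x)"

text \<open>
  \<open>formal_solution lq L v s \<mu> \<phi> u\<close>: the formal series \<open>x\<^sup>\<mu> \<Sum>\<^sub>n u\<^sub>n(x)\<close>, with
  \<open>u\<^sub>n = a\<^sub>n \<phi>\<^sub>n\<close> and \<open>\<phi>\<^sub>n\<close> a polynomial of degree \<open>n\<close> in \<open>v(x)\<close>, is a formal solution of
  \<open>L g = 0\<close>.  Here \<open>d n m\<close> is the (unique) coefficient of \<open>\<phi>\<^sub>m\<close> in the expansion of
  \<open>x\<^sup>-\<^sup>\<mu> x\<^sup>-\<^sup>s L(x\<^sup>\<mu> u\<^sub>n)\<close>; the total coefficient of \<open>\<phi>\<^sub>m\<close> is required to be a finite sum.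
  Two cases occur: \<open>v(x) = x\<close> with \<open>s = 0\<close>, and \<open>v(x) = 1/x\<close> with \<open>s = 2\<close>.
\<close>

definition formal_solution ::
    "complex \<Rightarrow> ((complex \<Rightarrow> complex) \<Rightarrow> complex \<Rightarrow> complex) \<Rightarrow> (complex \<Rightarrow> complex) \<Rightarrow> nat \<Rightarrow>
     complex \<Rightarrow> (nat \<Rightarrow> complex \<Rightarrow> complex) \<Rightarrow> (nat \<Rightarrow> complex \<Rightarrow> complex) \<Rightarrow> bool" where
  "formal_solution lq L v s \<mu> \<phi> u \<longleftrightarrow>
     (\<exists>p :: nat \<Rightarrow> complex poly. \<forall>n. p n \<noteq> 0 \<and> degree (p n) = n \<and>
        (\<forall>x. x \<noteq> 0 \<longrightarrow> \<phi> n x = poly (p n) (v x))) \<and>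
     (\<exists>a :: nat \<Rightarrow> complex. \<forall>n x. x \<noteq> 0 \<longrightarrow> u n x = a n * \<phi> n x) \<and>
     (\<exists>d :: nat \<Rightarrow> nat \<Rightarrow> complex.
        (\<forall>n. finite {m. d n m \<noteq> 0} \<and>
           (\<forall>X x. xpow_symbol lq \<mu> X \<longrightarrow> x \<noteq> 0 \<longrightarrow>
              L (\<lambda>y. X y * u n y) x / X x / x ^ s = (\<Sum>m | d n m \<noteq> 0. d n m * \<phi> m x))) \<and>
        (\<forall>m. finite {n. d n m \<noteq> 0} \<and> (\<Sum>n | d n m \<noteq> 0. d n m) = 0))"

definition formal_solution_poly ::
    "complex \<Rightarrow> ((complex \<Rightarrow> complex) \<Rightarrow> complex \<Rightarrow> complex) \<Rightarrow>
     complex \<Rightarrow> (nat \<Rightarrow> complex \<Rightarrow> complex) \<Rightarrow> (nat \<Rightarrow> complex \<Rightarrow> complex) \<Rightarrow> bool" where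
  "formal_solution_poly lq L = formal_solution lq L (\<lambda>x. x) 0"

definition formal_solution_inv_poly ::
    "complex \<Rightarrow> ((complex \<Rightarrow> complex) \<Rightarrow> complex \<Rightarrow> complex) \<Rightarrow>
     complex \<Rightarrow> (nat \<Rightarrow> complex \<Rightarrow> complex) \<Rightarrow> (nat \<Rightarrow> complex \<Rightarrow> complex) \<Rightarrow> bool" where
  "formal_solution_inv_poly lq L = formal_solution lq L (\<lambda>x. 1 / x) 2"

lemma power_int_inj_of_no_root_of_unity:
  fixes q :: complex
  assumes q: "q \<noteq> 0" and nr: "\<And>n::nat. n > 0 \<Longrightarrow> q ^ n \<noteq> 1"
    and eq: "q powi i = q powi j"
  shows "i = j"
proof -
  have aux: "\<not> a < b" if ab: "q powi a = q powi b" for a b :: int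
  proof
    assume "a < b"
    have "q powi (b - a) = 1"
      using ab q by (simp add: power_int_diff)
    moreover have "q powi (b - a) = q ^ nat (b - a)"
      using \<open>a < b\<close> by (simp add: power_int_def)
    ultimately show False using nr[of "nat (b - a)"] \<open>a < b\<close> by simp
  qed
  from aux[OF eq] aux[OF eq[symmetric]] show ?thesis by linarith
qed

lemma xpow_symbol_exists:
  assumes nr: "\<And>n::nat. n > 0 \<Longrightarrow> exp lq ^ n \<noteq> (1 :: complex)"
  shows "\<exists>X. xpow_symbol lq \<mu> X"
proof -
  define q where "q = exp lq"
  have q0: "q \<noteq> 0" by (simp add: q_def)
  define orb where "orb x = range (\<lambda>k::int. q powi k * x)" for x
  define rep where "rep x = (SOME y. y \<in> orb x)" for x
  have orb_shift: "orb (q powi k * x) = orb x" for k x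
  proof -
    have 1: "orb (q powi k * x) \<subseteq> orb x" for k x
    proof
      fix y assume "y \<in> orb (q powi k * x)"
      then obtain i where "y = q powi i * (q powi k * x)" by (auto simp: orb_def)
      then have "y = q powi (i + k) * x" using q0 by (simp add: power_int_add)
      then show "y \<in> orb x" by (auto simp: orb_def)
    qed
    have "x = q powi (- k) * (q powi k * x)"
      using q0 by (simp add: power_int_minus)
    then have "orb x \<subseteq> orb (q powi k * x)" using 1 by metis
    with 1 show ?thesis by blast
  qed
  have rep_shift: "rep (q powi k * x) = rep x" for k x
    by (simp add: rep_def orb_shift)
  have "\<exists>k::int. x = q powi k * rep x" for x
  proof -
    have "q powi 0 * x \<in> orb x" unfolding orb_def by blast
    then have "rep x \<in> orb x" unfolding rep_def by (rule someI)
    then obtain k where "rep x = q powi k * x" by (auto simp: orb_def)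
    then have "x = q powi (- k) * rep x" using q0 by (simp add: power_int_minus)
    then show ?thesis by blast
  qed
  then obtain e where e: "\<And>x. x = q powi (e x) * rep x" by metis
  have e_shift: "e (q powi k * x) = k + e x" if "x \<noteq> 0" for k x
  proof -
    have r: "rep x \<noteq> 0" using e[of x] that by auto
    have "q powi (e (q powi k * x)) * rep x = q powi k * x"
      using e[of "q powi k * x"] by (simp add: rep_shift)
    also have "\<dots> = q powi k * (q powi (e x) * rep x)" using e[of x] by simp
    also have "\<dots> = q powi (k + e x) * rep x" using q0 by (simp add: power_int_add)
    finally have "q powi (e (q powi k * x)) = q powi (k + e x)" using r by simp
    then show ?thesis
      using power_int_inj_of_no_root_of_unity[OF q0] nr by (auto simp: q_def)
  qed
  define X where "X x = qpow lq \<mu> powi e x" for x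
  have p0: "qpow lq \<mu> \<noteq> 0" by (simp add: qpow_def)
  have "xpow_symbol lq \<mu> X"
    unfolding xpow_symbol_def
  proof (intro allI impI conjI)
    fix x :: complex assume x: "x \<noteq> 0"
    show "X x \<noteq> 0" using p0 by (simp add: X_def)
    have "e (exp lq * x) = 1 + e x" using e_shift[OF x, of 1] by (simp add: q_def)
    then show "X (exp lq * x) = qpow lq \<mu> * X x"
      using p0 by (simp add: X_def power_int_add)
    have "e (x / exp lq) = - 1 + e x" using e_shift[OF x, of "-1"]
      by (simp add: q_def power_int_minus field_simps)
    moreover have "qpow lq (- \<mu>) = inverse (qpow lq \<mu>)" by (simp add: qpow_def exp_minus)
    ultimately show "X (x / exp lq) = qpow lq (- \<mu>) * X x"
      using p0 by (simp add: X_def power_int_diff divide_inverse)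
  qed
  then show ?thesis by blast
qed

end

theory Submission
  imports Defs "HOL-Computational_Algebra.Formal_Power_Series"
begin

text \<open>
  With \<open>A = q\<^bsup>h1+1/2\<^esup> t1\<close>, \<open>B1 = q\<^bsup>l1-1/2\<^esup> t1\<close>, \<open>B2 = q\<^bsup>l2-1/2\<^esup> t2\<close> the equation becomes symmetric in
  \<open>B1\<close> and \<open>B2\<close>. Applied to \<open>x\<^sup>\<mu> \<phi>\<^sub>n\<close> its left-hand side is a combination of
  \<open>\<phi>\<^sub>n\<^sub>+\<^sub>2\<close>, \<open>\<phi>\<^sub>n\<^sub>+\<^sub>1\<close>, \<open>\<phi>\<^sub>n\<close>, \<open>\<phi>\<^sub>n\<^sub>-\<^sub>1\<close>, so the coefficients
  have to satisfy a four-term recurrence. In (i) it is a combination of three consecutive instances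
  of the two-term recurrence of the \<open>\<^sub>2\<phi>\<^sub>2\<close> coefficients.

  Let \<open>s = q\<^bsup>\<lambda>+\<alpha>1\<^esup>\<close>. In (ii) and (iii), writing the coefficients as
  \<open>(-q B/s)\<^sup>n q\<^bsup>-n^2\<^esup> (s;q)\<^sub>n h\<^sub>n\<close>, with \<open>B = B1\<close> or \<open>B = B2\<close>, reduces it to a single three-term
  recurrence for \<open>h\<close>, the same in both cases up to exchanging \<open>B1\<close> and \<open>B2\<close>. Up to elementary
  factors \<open>h\<close> is the convolution of an explicit sequence with \<open>q\<^bsup>j(j-1)/2\<^esup> / (q;q)\<^sub>j\<close>, whose generating
  function satisfies \<open>F(w) = (1 + w) F(q w)\<close>; multiplying the \<open>q\<close>-difference equation of the
  other factor by \<open>F\<close> therefore gives that of the product, hence the recurrence.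
\<close>

section \<open>Finite expansions and a four-term criterion for formal solutions\<close>

definition shift :: "(nat \<Rightarrow> complex) \<Rightarrow> nat \<Rightarrow> complex" where
  "shift f n = (if n = 0 then 0 else f (n - 1))"

lemma shift_0 [simp]: "shift f 0 = 0"
  and shift_Suc [simp]: "shift f (Suc n) = f n"
  by (simp_all add: shift_def)

text \<open>A coefficient depending on n only through \<open>q ^ n\<close> becomes, after a shift,
  the same expression at \<open>q ^ m / q\<close>, so the total coefficient of
  \<open>\<phi> m\<close> can be written in the single quantity \<open>N = q ^ m\<close>. At
  \<open>m = 0\<close> both sides vanish by the default value of \<open>shift\<close>.\<close>

lemma shift_mult_power:
  fixes q :: complex
  assumes "q \<noteq> 0"
  shows "shift (\<lambda>n. f n * E (q ^ n)) m = shift f m * E (q ^ m / q)"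
  using assms by (cases m) simp_all

lemma sum_singleton_support:
  fixes c :: "'a \<Rightarrow> complex"
  assumes "finite S"
  shows "(\<Sum>i\<in>S. (if i = k then c i else 0) * w i) = (if k \<in> S then c k * w k else 0)"
  using assms by (subst if_distrib[of "\<lambda>t. t * _"]) (simp add: if_distrib cong: if_cong)

text \<open>For \<open>n = 0\<close> the term \<open>\<phi> (n - 1)\<close> is junk; \<open>em 0 = 0\<close> suppresses it.\<close>

lemma formal_solution_four_term:
  assumes poly: "\<And>n. p n \<noteq> 0 \<and> degree (p n) = n \<and> (\<forall>x. x \<noteq> 0 \<longrightarrow> \<phi> n x = poly (p n) (v x))"
    and u: "\<And>n x. x \<noteq> 0 \<Longrightarrow> u n x = a n * \<phi> n x"
    and expand: "\<And>n X x. xpow_symbol lq \<mu> X \<Longrightarrow> x \<noteq> 0 \<Longrightarrow>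
        L (\<lambda>y. X y * u n y) x / X x / x ^ s
          = e2 n * \<phi> (Suc (Suc n)) x + e1 n * \<phi> (Suc n) x + e0 n * \<phi> n x + em n * \<phi> (n - 1) x"
    and em0: "em 0 = 0"
    and total: "\<And>m. shift (shift e2) m + shift e1 m + e0 m + em (Suc m) = 0"
  shows "formal_solution lq L v s \<mu> \<phi> u"
proof -
  \<comment> \<open>A band matrix: row n expands the image of the n-th term, and column m collects
    contributions of the terms m - 2 to m + 1. The last condition is \<open>Suc m = n\<close>, not
    \<open>m = n - 1\<close>, so that row 0 gets no entry from \<open>em\<close>.\<close>
  define d where "d n m = (if m = Suc (Suc n) then e2 n else 0) + (if m = Suc n then e1 n else 0)
      + (if m = n then e0 n else 0) + (if Suc m = n then em n else 0)" for n m
  have row: "{m. d n m \<noteq> 0} \<subseteq> {..Suc (Suc n)}" for n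
    by (auto simp: d_def split: if_splits)
  then have fin_row: "finite {m. d n m \<noteq> 0}" for n
    by (rule finite_subset) simp
  have col: "{n. d n m \<noteq> 0} \<subseteq> {..Suc m}" for m
    by (auto simp: d_def split: if_splits)
  then have fin_col: "finite {n. d n m \<noteq> 0}" for m
    by (rule finite_subset) simp
  have row_sum: "(\<Sum>m | d n m \<noteq> 0. d n m * \<phi> m x)
      = e2 n * \<phi> (Suc (Suc n)) x + e1 n * \<phi> (Suc n) x + e0 n * \<phi> n x + em n * \<phi> (n - 1) x" for n x
  proof -
    have "(\<Sum>m | d n m \<noteq> 0. d n m * \<phi> m x) = (\<Sum>m\<le>Suc (Suc n). d n m * \<phi> m x)"
      by (rule sum.mono_neutral_left) (use row in auto)
    \<comment> \<open>Here \<open>Suc m = n\<close> is replaced by \<open>m = n - 1\<close>; the two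
      differ only at \<open>n = 0\<close>, where \<open>em 0 = 0\<close>.\<close>
    also have "\<dots> = (\<Sum>m\<le>Suc (Suc n). (if m = Suc (Suc n) then e2 n else 0) * \<phi> m x)
        + (\<Sum>m\<le>Suc (Suc n). (if m = Suc n then e1 n else 0) * \<phi> m x)
        + (\<Sum>m\<le>Suc (Suc n). (if m = n then e0 n else 0) * \<phi> m x)
        + (\<Sum>m\<le>Suc (Suc n). (if m = n - 1 then em n else 0) * \<phi> m x)"
      unfolding d_def sum.distrib[symmetric] using em0
      by (intro sum.cong refl) (cases n; auto simp: algebra_simps)
    finally show ?thesis
      by (simp only: sum_singleton_support finite_atMost) auto
  qed
  have col_sum: "(\<Sum>n | d n m \<noteq> 0. d n m) = 0" for m
  proof -
    have "(\<Sum>n | d n m \<noteq> 0. d n m) = (\<Sum>n\<le>Suc m. d n m)"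
      by (rule sum.mono_neutral_left) (use col in auto)
    also have "\<dots> = shift (shift e2) m + shift e1 m + e0 m + em (Suc m)"
    proof -
      have "(\<Sum>n\<le>Suc m. if m = Suc (Suc n) then e2 n else 0) = shift (shift e2) m"
        by (cases m; cases "m - 1") (auto simp: sum.delta')
      moreover have "(\<Sum>n\<le>Suc m. if m = Suc n then e1 n else 0) = shift e1 m"
        by (cases m) (auto simp: sum.delta')
      moreover have "(\<Sum>n\<le>Suc m. if m = n then e0 n else 0) = e0 m"
        by (simp add: sum.delta)
      moreover have "(\<Sum>n\<le>Suc m. if Suc m = n then em n else 0) = em (Suc m)"
        by (simp add: sum.delta)
      ultimately show ?thesis by (simp only: d_def sum.distrib)
    qed
    finally show ?thesis using total by simp
  qed
  show ?thesis
    unfolding formal_solution_def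
  proof (intro conjI)
    show "\<exists>p :: nat \<Rightarrow> complex poly. \<forall>n. p n \<noteq> 0 \<and> degree (p n) = n \<and>
        (\<forall>x. x \<noteq> 0 \<longrightarrow> \<phi> n x = poly (p n) (v x))"
      using poly by blast
    show "\<exists>a :: nat \<Rightarrow> complex. \<forall>n x. x \<noteq> 0 \<longrightarrow> u n x = a n * \<phi> n x"
      using u by blast
    show "\<exists>d :: nat \<Rightarrow> nat \<Rightarrow> complex.
        (\<forall>n. finite {m. d n m \<noteq> 0} \<and>
           (\<forall>X x. xpow_symbol lq \<mu> X \<longrightarrow> x \<noteq> 0 \<longrightarrow>
              L (\<lambda>y. X y * u n y) x / X x / x ^ s = (\<Sum>m | d n m \<noteq> 0. d n m * \<phi> m x))) \<and>
        (\<forall>m. finite {n. d n m \<noteq> 0} \<and> (\<Sum>n | d n m \<noteq> 0. d n m) = 0)"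
      using expand fin_row fin_col by (intro exI[of _ d]) (simp add: row_sum col_sum)
  qed
qed

section \<open>Shifted products as polynomial bases\<close>

definition qfac :: "complex \<Rightarrow> complex \<Rightarrow> nat \<Rightarrow> complex \<Rightarrow> complex" where
  "qfac r q n y = (\<Prod>j<n. y - r * q ^ j)"

lemma qfac_0 [simp]: "qfac r q 0 y = 1"
  and qfac_Suc [simp]: "qfac r q (Suc n) y = (y - r * q ^ n) * qfac r q n y"
  by (simp_all add: qfac_def)

lemma qfac_poly:
  "\<exists>p. p \<noteq> 0 \<and> degree p = n \<and> (\<forall>y. qfac r q n y = poly p y)"
proof -
  let ?p = "\<Prod>j<n. [:- r * q ^ j, 1:]"
  have "?p \<noteq> 0" by simp
  moreover have "degree ?p = n" by (simp add: degree_prod_eq_sum_degree)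
  moreover have "qfac r q n y = poly ?p y" for y
    by (simp add: qfac_def poly_prod algebra_simps)
  ultimately show ?thesis by blast
qed

text \<open>The factors at \<open>y / q\<close> are \<open>(y - r q^(j+1)) / q\<close>, so the extra
  factor \<open>y - r\<close> supplies the missing initial one.\<close>

lemma qfac_div:
  assumes "q \<noteq> 0"
  shows "(y - r) * qfac r q n (y / q) = qfac r q (Suc n) y / q ^ n"
proof (induction n)
  case (Suc n)
  have "(y - r) * qfac r q (Suc n) (y / q) = (y / q - r * q ^ n) * ((y - r) * qfac r q n (y / q))"
    by simp
  also have "\<dots> = qfac r q (Suc (Suc n)) y / q ^ Suc n"
    unfolding Suc.IH using assms by (simp add: field_simps)
  finally show ?case .
qed simp

text \<open>At \<open>q * y\<close> the factors slide down by one index: a new first factor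
  \<open>y - r / q\<close> appears and the last one is lost. The form with \<open>Suc n\<close>
  avoids a predecessor.\<close>

lemma qfac_mult:
  assumes "q \<noteq> 0"
  shows "qfac r q (Suc n) (q * y) = q ^ Suc n * (y - r / q) * qfac r q n y"
proof (induction n)
  case (Suc n)
  have "qfac r q (Suc (Suc n)) (q * y) = (q * y - r * q ^ Suc n) * qfac r q (Suc n) (q * y)"
    by simp
  also have "\<dots> = q ^ Suc (Suc n) * (y - r / q) * qfac r q (Suc n) y"
    unfolding Suc.IH by (simp add: algebra_simps)
  finally show ?case .
qed (use assms in \<open>simp add: field_simps\<close>)

lemma qpoch_0 [simp]: "qpoch a q 0 = 1"
  and qpoch_Suc [simp]: "qpoch a q (Suc n) = qpoch a q n * (1 - a * q ^ n)"
  by (simp_all add: qpoch_def)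

lemma qpoch_mult_power_eq_qfac:
  assumes "x \<noteq> 0"
  shows "qpoch (r / x) q n * x ^ n = qfac r q n x"
  using assms by (induction n) (simp_all add: field_simps)

lemma qpoch_self_nonzero:
  assumes "\<forall>n::nat. n > 0 \<longrightarrow> q ^ n \<noteq> 1"
  shows "qpoch q q n \<noteq> 0"
  using assms[rule_format, of "Suc _"] by (auto simp: qpoch_def)

section \<open>The equation in terms of the roots of its coefficients\<close>

text \<open>The equation in the parameters \<open>A\<close>, \<open>B1\<close>, \<open>B2\<close>, with \<open>\<alpha> = q\<^bsup>\<alpha>1\<^esup>\<close> and \<open>\<Lambda> = q\<^sup>\<lambda>\<close>.\<close>

definition vconf_op ::
    "complex \<Rightarrow> complex \<Rightarrow> complex \<Rightarrow> complex \<Rightarrow> complex \<Rightarrow> complex \<Rightarrow>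
     (complex \<Rightarrow> complex) \<Rightarrow> complex \<Rightarrow> complex" where
  "vconf_op q A B1 B2 \<alpha> \<Lambda> g x =
     (x - B1) * (x - B2) * g (q * x) - q * \<Lambda>\<^sup>2 * B1 * B2 / A * (x - A) * g (x / q)
     - (x\<^sup>2 / \<alpha> - \<Lambda> * (B1 + B2 + q * B1 * B2 / A) * x + \<Lambda> * (1 + q) * B1 * B2) * g x"

text \<open>Lets the expansion based at \<open>B1\<close> serve, with roles exchanged, for the one
  based at \<open>B2\<close>.\<close>

lemma vconf_op_commute: "vconf_op q A B1 B2 \<alpha> \<Lambda> = vconf_op q A B2 B1 \<alpha> \<Lambda>"
  by (intro ext) (simp add: vconf_op_def mult_ac add_ac)

lemma qpow_add: "qpow lq (a + b) = qpow lq a * qpow lq b"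
  and qpow_minus: "qpow lq (- a) = 1 / qpow lq a"
  and qpow_diff: "qpow lq (a - b) = qpow lq a / qpow lq b"
  and qpow_nonzero [simp]: "qpow lq a \<noteq> 0"
  by (simp_all add: qpow_def distrib_right exp_add left_diff_distrib exp_diff exp_minus divide_inverse)

lemma qpow_of_nat_mult: "qpow lq (of_nat n * a) = qpow lq a ^ n"
  by (simp add: qpow_def exp_of_nat_mult mult.assoc)

lemma qpow_half_power2: "qpow lq (1 / 2) ^ 2 = exp lq"
  unfolding qpow_def by (simp add: exp_of_nat_mult[symmetric])

lemma qpow_one: "qpow lq 1 = exp lq"
  by (simp add: qpow_def)

lemma qpow_double: "qpow lq (2 * a) = qpow lq a ^ 2"
  using qpow_of_nat_mult[of lq 2 a] by simp

lemma qpow_three_halves: "qpow lq (3 / 2) = qpow lq (1 / 2) ^ 3"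
  using qpow_of_nat_mult[of lq 3 "1/2"] by simp

lemmas qpow_simps = qpow_add qpow_minus qpow_diff qpow_one qpow_double qpow_three_halves

lemma vconf_lhs_eq_vconf_op:
  assumes "t1 \<noteq> 0" "t2 \<noteq> 0"
  shows "vconf_lhs lq h1 l1 l2 \<alpha>1 lam t1 t2 =
    vconf_op (exp lq) (qpow lq (h1 + 1/2) * t1) (qpow lq (l1 - 1/2) * t1) (qpow lq (l2 - 1/2) * t2)
      (qpow lq \<alpha>1) (qpow lq lam)"
proof (intro ext)
  fix g x
  \<comment> \<open>Since \<open>q = Q\<^sup>2\<close>, half-integral exponents become integer
    powers of \<open>Q\<close>, and the coefficients are compared as rational functions.\<close>
  define Q where "Q = qpow lq (1/2)"
  have Q0: "Q \<noteq> 0" by (simp add: Q_def)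
  have q: "exp lq = Q\<^sup>2" by (simp add: Q_def qpow_half_power2)
  have c1: "qpow lq (- h1 + l1 + l2 + 2 * lam - 1/2) * t2
      = Q\<^sup>2 * (qpow lq lam)\<^sup>2 * (qpow lq l1 / Q * t1) * (qpow lq l2 / Q * t2) / (qpow lq h1 * Q * t1)"
    using assms Q0 unfolding qpow_simps Q_def[symmetric]
    by (simp add: field_simps power2_eq_square)
  have c2: "qpow lq (l1 + l2 + lam - 1/2) * (qpow lq (- l2) * t1 + (qpow lq (- h1) + qpow lq (- l1)) * t2)
     = qpow lq lam * (qpow lq l1 / Q * t1 + qpow lq l2 / Q * t2
        + Q\<^sup>2 * (qpow lq l1 / Q * t1) * (qpow lq l2 / Q * t2) / (qpow lq h1 * Q * t1))"
    using assms Q0 unfolding qpow_simps Q_def[symmetric]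
    by (simp add: field_simps power2_eq_square)
  have c3: "qpow lq (l1 + l2 + lam) * (1 + inverse (Q\<^sup>2)) * t1 * t2
     = qpow lq lam * (1 + Q\<^sup>2) * (qpow lq l1 / Q * t1) * (qpow lq l2 / Q * t2)"
    using assms Q0 unfolding qpow_simps Q_def[symmetric]
    by (simp add: field_simps power2_eq_square)
  show "vconf_lhs lq h1 l1 l2 \<alpha>1 lam t1 t2 g x =
    vconf_op (exp lq) (qpow lq (h1 + 1/2) * t1) (qpow lq (l1 - 1/2) * t1) (qpow lq (l2 - 1/2) * t2)
      (qpow lq \<alpha>1) (qpow lq lam) g x"
    unfolding vconf_lhs_def vconf_op_def Let_def q c1 c2 c3
    unfolding qpow_add[of lq h1 "1/2"] qpow_diff[of lq _ "1/2"] Q_def[symmetric] qpow_minus[of lq \<alpha>1]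
    by simp
qed

section \<open>Reduction of the equation to coefficient recurrences\<close>

lemma formal_solution_polyI:
  assumes nz: "q \<noteq> 0" "A \<noteq> 0" "B1 \<noteq> 0" "B2 \<noteq> 0" "qpow lq \<alpha>1 \<noteq> 0"
    and q: "q = exp lq"
    and u: "\<And>n x. x \<noteq> 0 \<Longrightarrow> u n x = a n * qfac A q n x"
    and \<phi>: "\<And>n x. x \<noteq> 0 \<Longrightarrow> \<phi> n x = qfac A q n x"
    and rec: "\<And>n. a (Suc n) * (1 - q * q ^ n) * (B1 - A * q ^ n) * (B2 - A * q ^ n)
        = - A * q ^ n * (1 / (qpow lq \<alpha>1 * qpow lq lam) - q ^ n) * a n"
  shows "formal_solution_poly lq (vconf_op q A B1 B2 (qpow lq \<alpha>1) (qpow lq lam)) lam \<phi> u"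
proof -
  define \<alpha> \<Lambda> where "\<alpha> = qpow lq \<alpha>1" and "\<Lambda> = qpow lq lam"
  have nz': "\<alpha> \<noteq> 0" "\<Lambda> \<noteq> 0" by (simp_all add: \<alpha>_def \<Lambda>_def)
  \<comment> \<open>The coefficients of the expansion as functions of \<open>N = q ^ n\<close>,
    found by repeatedly replacing x P_n by P_(n+1) + A N P_n. Only \<open>g (q * x)\<close> reaches
    P_(n-1), which is why \<open>Em\<close> contains (x - B1) (x - B2) evaluated at the root x = A N
    / q.\<close>
  define E2 where "E2 N = \<Lambda> * N - 1 / \<alpha>" for N
  define E1 where "E1 N = \<Lambda> * N * (A * q * N - B1 + A * N - B2 + A * (N - 1) / q)
     - q * \<Lambda> * B1 * B2 / (A * N) + \<Lambda> * (B1 + B2 + q * B1 * B2 / A) - (A * N + A * q * N) / \<alpha>" for N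
  define E0 where "E0 N = \<Lambda> * N * ((A * N - B1) * (A * N - B2)
       + A * (N - 1) / q * (A * N + A * N / q - B1 - B2))
     - ((A * N)\<^sup>2 / \<alpha> - \<Lambda> * (B1 + B2 + q * B1 * B2 / A) * A * N + \<Lambda> * (1 + q) * B1 * B2)" for N
  define Em where "Em N = \<Lambda> * N * (A * (N - 1) / q) * (A * N / q - B1) * (A * N / q - B2)" for N
  show ?thesis
    unfolding formal_solution_poly_def \<alpha>_def[symmetric] \<Lambda>_def[symmetric]
  proof (rule formal_solution_four_term)
    define p where "p n = (SOME p. p \<noteq> 0 \<and> degree p = n \<and> (\<forall>y. qfac A q n y = poly p y))" for n
    show "p n \<noteq> 0 \<and> degree (p n) = n \<and> (\<forall>x. x \<noteq> 0 \<longrightarrow> \<phi> n x = poly (p n) x)" for n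
      using someI_ex[OF qfac_poly[of n A q]] \<phi> unfolding p_def by metis
    show "u n x = a n * \<phi> n x" if "x \<noteq> 0" for n x
      using that u \<phi> by simp
  next
    fix n X and x :: complex
    assume X: "xpow_symbol lq lam X" and x: "x \<noteq> 0"
    have X': "X x \<noteq> 0" "X (q * x) = \<Lambda> * X x" "X (x / q) = X x / \<Lambda>"
      using X x by (simp_all add: xpow_symbol_def q \<Lambda>_def qpow_minus)
    define P where "P k = qfac A q k x" for k
    define N where "N = q ^ n"
    have N: "N \<noteq> 0" using nz by (simp add: N_def)
    have P1: "P (Suc n) = (x - A * N) * P n" and P2: "P (Suc (Suc n)) = (x - A * q * N) * (x - A * N) * P n"
      by (simp_all add: P_def N_def)
    \<comment> \<open>For \<open>n = 0\<close> the term \<open>P (n - 1)\<close> is just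
      \<open>P 0\<close>; the factor \<open>N - 1\<close>, which vanishes there, makes this relation
      and the next one uniform in n.\<close>
    have down: "(N - 1) * P n = (N - 1) * (x - A * N / q) * P (n - 1)"
      using nz by (cases n) (simp_all add: P_def N_def)
    have mult: "qfac A q n (q * x) = N * (P n + A * (N - 1) / q * P (n - 1))"
    proof (cases n)
      case (Suc k)
      show ?thesis
        unfolding Suc qfac_mult[OF nz(1)] using nz by (simp add: P_def N_def Suc field_simps)
    qed (simp add: P_def N_def)
    \<comment> \<open>\<open>x - A\<close> is the coefficient of \<open>g (x / q)\<close>: starting
      the basis at the root \<open>A\<close> turns this term into a multiple of
      \<open>P (Suc n)\<close>.\<close>
    have div: "(x - A) * qfac A q n (x / q) = (x - A * N) * P n / N"
      unfolding qfac_div[OF nz(1)] by (simp add: P_def N_def)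
    have "vconf_op q A B1 B2 \<alpha> \<Lambda> (\<lambda>y. X y * u n y) x / X x / x ^ 0
        = a n * ((x - B1) * (x - B2) * \<Lambda> * qfac A q n (q * x)
          - q * \<Lambda> * B1 * B2 / A * ((x - A) * qfac A q n (x / q))
          - (x\<^sup>2 / \<alpha> - \<Lambda> * (B1 + B2 + q * B1 * B2 / A) * x + \<Lambda> * (1 + q) * B1 * B2) * P n)"
    proof -
      have "u n (q * x) = a n * qfac A q n (q * x)" "u n (x / q) = a n * qfac A q n (x / q)"
          "u n x = a n * P n"
        using u x nz by (simp_all add: P_def)
      then show ?thesis
        unfolding vconf_op_def X' using x nz nz' X'(1)
        by (simp add: divide_simps) (simp add: algebra_simps power2_eq_square)
    qed
    also have "\<dots> = a n * (E2 N * P (Suc (Suc n)) + E1 N * P (Suc n) + E0 N * P n + Em N * P (n - 1))"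
    \<comment> \<open>Once P_(n+1) and P_(n+2) are written through P_n, the two sides differ exactly
      by a multiple of \<open>down\<close>.\<close>
    proof -
      have "(x - B1) * (x - B2) * \<Lambda> * qfac A q n (q * x)
          - q * \<Lambda> * B1 * B2 / A * ((x - A) * qfac A q n (x / q))
          - (x\<^sup>2 / \<alpha> - \<Lambda> * (B1 + B2 + q * B1 * B2 / A) * x + \<Lambda> * (1 + q) * B1 * B2) * P n
        - (E2 N * P (Suc (Suc n)) + E1 N * P (Suc n) + E0 N * P n + Em N * P (n - 1))
        = \<Lambda> * N * A / q * (x + A * N / q - B1 - B2) *
          ((N - 1) * (x - A * N / q) * P (n - 1) - (N - 1) * P n)"
        unfolding mult div P1 P2 E2_def E1_def E0_def Em_def using nz nz' N
        by (simp add: divide_simps) (simp add: algebra_simps power2_eq_square)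
      then show ?thesis by (simp add: down)
    qed
    finally show "vconf_op q A B1 B2 \<alpha> \<Lambda> (\<lambda>y. X y * u n y) x / X x / x ^ 0
        = (a n * E2 (q ^ n)) * \<phi> (Suc (Suc n)) x + (a n * E1 (q ^ n)) * \<phi> (Suc n) x
          + (a n * E0 (q ^ n)) * \<phi> n x + (a n * Em (q ^ n)) * \<phi> (n - 1) x"
      unfolding \<phi>[OF x] by (simp only: P_def N_def distrib_left mult.assoc)
  next
    show "a 0 * Em (q ^ 0) = 0" by (simp add: Em_def)
  next
    fix m
    define N where "N = q ^ m"
    have N: "N \<noteq> 0" using nz by (simp add: N_def)
    have r1: "a (Suc m) * (1 - q * N) * (B1 - A * N) * (B2 - A * N) = - A * N * (1 / (\<alpha> * \<Lambda>) - N) * a m"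
      using rec[of m] by (simp add: N_def \<alpha>_def \<Lambda>_def)
    \<comment> \<open>The two preceding instances of \<open>rec\<close>, valid for all m: where no
      predecessor exists, both sides vanish through \<open>1 - N\<close>, \<open>1 - N / q\<close>
      or the value of \<open>shift\<close> at 0.\<close>
    have r0: "a m * (1 - N) * (B1 - A * N / q) * (B2 - A * N / q)
        = - A * N / q * (1 / (\<alpha> * \<Lambda>) - N / q) * shift a m"
    proof (cases m)
      case (Suc k)
      then show ?thesis using rec[of k] nz by (simp add: N_def \<alpha>_def \<Lambda>_def)
    qed (simp add: N_def)
    have rm: "shift a m * (1 - N / q) * (B1 - A * N / q / q) * (B2 - A * N / q / q)
        = - A * N / q / q * (1 / (\<alpha> * \<Lambda>) - N / q / q) * shift (shift a) m"
    proof (cases m)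
      case m: (Suc k)
      show ?thesis
      proof (cases k)
        case (Suc l)
        then show ?thesis using rec[of l] nz m by (simp add: N_def \<alpha>_def \<Lambda>_def)
      qed (use nz m in \<open>simp add: N_def\<close>)
    qed (simp add: N_def)
    \<comment> \<open>The weight of the newest instance is forced by the coefficient of
      \<open>a (Suc m)\<close>, that of the oldest by \<open>shift (shift a) m\<close>.\<close>
    have "shift (shift a) m * E2 (N / q / q) + shift a m * E1 (N / q) + a m * E0 N + a (Suc m) * Em (q * N)
       = \<Lambda> * A * N * (a (Suc m) * (1 - q * N) * (B1 - A * N) * (B2 - A * N)
              + A * N * (1 / (\<alpha> * \<Lambda>) - N) * a m) * (-1)
         - \<Lambda> * (1 + q) * (a m * (1 - N) * (B1 - A * N / q) * (B2 - A * N / q)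
              + A * N / q * (1 / (\<alpha> * \<Lambda>) - N / q) * shift a m)
         - \<Lambda> * q\<^sup>2 / (A * N) * (shift a m * (1 - N / q) * (B1 - A * N / q / q) * (B2 - A * N / q / q)
              + A * N / q / q * (1 / (\<alpha> * \<Lambda>) - N / q / q) * shift (shift a) m)"
      unfolding E2_def E1_def E0_def Em_def using nz nz' N
      by (simp add: divide_simps) (simp add: algebra_simps power2_eq_square)
    also have "\<dots> = 0" unfolding r1 r0 rm by simp
    finally have "shift (shift a) m * E2 (N / q / q) + shift a m * E1 (N / q) + a m * E0 N
        + a (Suc m) * Em (q * N) = 0" .
    then show "shift (shift (\<lambda>n. a n * E2 (q ^ n))) m + shift (\<lambda>n. a n * E1 (q ^ n)) m
        + a m * E0 (q ^ m) + a (Suc m) * Em (q ^ Suc m) = 0"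
      unfolding shift_mult_power[OF nz(1)] shift_mult_power[OF nz(1), of _ "\<lambda>N. E2 (N / q)"]
      by (simp add: N_def)
  qed
qed

text \<open>Here \<open>{B, B'} = {B1, B2}\<close> and \<open>b = A / B\<close>.\<close>

lemma formal_solution_inv_polyI:
  fixes h :: "nat \<Rightarrow> complex"
  assumes nz: "q \<noteq> 0" "b \<noteq> 0" "B \<noteq> 0" "B' \<noteq> 0"
    and q: "q = exp lq"
    and s: "s = qpow lq (lam + \<alpha>1)"
    and \<phi>: "\<And>n x. x \<noteq> 0 \<Longrightarrow> \<phi> n x = qfac (1 / B) q n (1 / x)"
    and u: "\<And>n x. x \<noteq> 0 \<Longrightarrow>
        u n x = (- q * B / s) ^ n / q ^ (n * n) * qpoch s q n * h n * qfac (1 / B) q n (1 / x)"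
    and rec: "\<And>n. h (Suc n) * (1 - q * q ^ n) * (1 - b * q ^ n)
        = h n * ((1 + b / q) * q ^ n - b / q * (1 + q) * (q ^ n)\<^sup>2 - b * B / (s * B' * q))
          - b * (q ^ n)\<^sup>2 / q\<^sup>2 * shift h n"
  shows "formal_solution_inv_poly lq (vconf_op q (b * B) B B' (qpow lq \<alpha>1) (qpow lq lam)) (- \<alpha>1) \<phi> u"
proof -
  define \<alpha> \<Lambda> where "\<alpha> = qpow lq \<alpha>1" and "\<Lambda> = qpow lq lam"
  have nz': "\<alpha> \<noteq> 0" "\<Lambda> \<noteq> 0" "s \<noteq> 0" by (simp_all add: \<alpha>_def \<Lambda>_def s)
  have s': "s = \<Lambda> * \<alpha>" by (simp add: s qpow_add \<alpha>_def \<Lambda>_def)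
  define a where "a n = (- q * B / s) ^ n / q ^ (n * n) * qpoch s q n * h n" for n
  \<comment> \<open>The factors \<open>1 - s * N\<close> are kept visible in \<open>E2\<close> and
    \<open>E1\<close>, to be merged with the \<open>qpoch s q n\<close> contained in
    \<open>a\<close>.\<close>
  define E2 where "E2 N = B * B' / (\<alpha> * N) * ((1 - s * N) * (1 - s * q * N))" for N
  define E1 where "E1 N = B' / \<alpha> * ((1 - s * N)
      * (s * q / b + s + q - (1 + q + q\<^sup>2) * s * N - B / (B' * N)))" for N
  define E0 where "E0 N = s * N / (\<alpha> * B) * (B + B' + q * B' / b) - 1 / \<alpha>
      - s * (1 + q) * B' * N\<^sup>2 / (\<alpha> * B)
      - s\<^sup>2 * B' * N / (b * \<alpha> * B) * (q * N * (1 - b * N) - (1 - N) * (1 - b * N - b * N / q))" for N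
  define Em where "Em N = B' * s\<^sup>2 * N\<^sup>2 / (\<alpha> * b * B\<^sup>2 * q) * ((1 - N) * (1 - b * N / q))" for N
  show ?thesis
    unfolding formal_solution_inv_poly_def \<alpha>_def[symmetric] \<Lambda>_def[symmetric]
  proof (rule formal_solution_four_term)
    define p where "p n = (SOME p. p \<noteq> 0 \<and> degree p = n \<and> (\<forall>y. qfac (1 / B) q n y = poly p y))" for n
    show "p n \<noteq> 0 \<and> degree (p n) = n \<and> (\<forall>x. x \<noteq> 0 \<longrightarrow> \<phi> n x = poly (p n) (1 / x))" for n
      using someI_ex[OF qfac_poly[of n "1 / B" q]] \<phi> unfolding p_def by metis
    show "u n x = a n * \<phi> n x" if "x \<noteq> 0" for n x
      using that u \<phi> by (simp add: a_def)
  next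
    fix n X and x :: complex
    assume X: "xpow_symbol lq (- \<alpha>1) X" and x: "x \<noteq> 0"
    have X': "X x \<noteq> 0" "X (q * x) = X x / \<alpha>" "X (x / q) = \<alpha> * X x"
      using X x by (simp_all add: xpow_symbol_def q \<alpha>_def qpow_minus)
    \<comment> \<open>In y = 1/x the dilations swap: \<open>g (q * x)\<close> leads to
      \<open>y / q\<close> and \<open>qfac_div\<close>, its coefficient \<open>x - B\<close>
      supplying the factor \<open>y - 1 / B\<close>, while \<open>g (x / q)\<close> leads to
      \<open>qfac_mult\<close>.\<close>
    define y where "y = 1 / x"
    have xy: "x = 1 / y" and y: "y \<noteq> 0" using x by (simp_all add: y_def)
    define P where "P k = qfac (1 / B) q k y" for k
    define N where "N = q ^ n"
    have N: "N \<noteq> 0" using nz by (simp add: N_def)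
    have P1: "P (Suc n) = (y - N / B) * P n" and P2: "P (Suc (Suc n)) = (y - q * N / B) * (y - N / B) * P n"
      by (simp_all add: P_def N_def)
    have down: "(N - 1) * P n = (N - 1) * (y - N / (B * q)) * P (n - 1)"
      using nz by (cases n) (simp_all add: P_def N_def field_simps)
    have mult: "qfac (1 / B) q n (q * y) = N * (P n + (N - 1) / (B * q) * P (n - 1))"
    proof (cases n)
      case (Suc k)
      show ?thesis
        unfolding Suc qfac_mult[OF nz(1)] using nz by (simp add: P_def N_def Suc field_simps)
    qed (simp add: P_def N_def)
    have div: "(y - 1 / B) * qfac (1 / B) q n (y / q) = (y - N / B) * P n / N"
      unfolding qfac_div[OF nz(1)] by (simp add: P_def N_def)
    have "vconf_op q (b * B) B B' \<alpha> \<Lambda> (\<lambda>y. X y * u n y) x / X x / x ^ 2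
        = a n * (- B * (1 - B' * y) / \<alpha> * ((y - 1 / B) * qfac (1 / B) q n (y / q))
          - q * s\<^sup>2 * B' / (\<alpha> * b) * y * (1 - b * B * y) * qfac (1 / B) q n (q * y)
          - (1 / \<alpha> - s / \<alpha> * (B + B' + q * B' / b) * y + s / \<alpha> * (1 + q) * B * B' * y\<^sup>2) * P n)"
    proof -
      have "u n (q * x) = a n * qfac (1 / B) q n (y / q)" "u n (x / q) = a n * qfac (1 / B) q n (q * y)"
          "u n x = a n * P n"
        using u x nz by (simp_all add: P_def a_def y_def mult.commute[of x q])
      then show ?thesis
        unfolding vconf_op_def X' using y nz nz' X'(1) unfolding s' xy
        by (simp add: divide_simps) (simp add: algebra_simps power2_eq_square)
    qed
    also have "\<dots> = a n * (E2 N * P (Suc (Suc n)) + E1 N * P (Suc n) + E0 N * P n + Em N * P (n - 1))"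
    proof -
      have "- B * (1 - B' * y) / \<alpha> * ((y - 1 / B) * qfac (1 / B) q n (y / q))
          - q * s\<^sup>2 * B' / (\<alpha> * b) * y * (1 - b * B * y) * qfac (1 / B) q n (q * y)
          - (1 / \<alpha> - s / \<alpha> * (B + B' + q * B' / b) * y + s / \<alpha> * (1 + q) * B * B' * y\<^sup>2) * P n
        - (E2 N * P (Suc (Suc n)) + E1 N * P (Suc n) + E0 N * P n + Em N * P (n - 1))
        = s\<^sup>2 * B' * N / (\<alpha> * b * B) * (b * B * y + b * N / q - 1) *
          ((N - 1) * (y - N / (B * q)) * P (n - 1) - (N - 1) * P n)"
        unfolding mult div P1 P2 E2_def E1_def E0_def Em_def using nz nz' N
        by (simp add: divide_simps) (simp add: algebra_simps power2_eq_square)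
      then show ?thesis by (simp add: down)
    qed
    finally show "vconf_op q (b * B) B B' \<alpha> \<Lambda> (\<lambda>y. X y * u n y) x / X x / x ^ 2
        = (a n * E2 (q ^ n)) * \<phi> (Suc (Suc n)) x + (a n * E1 (q ^ n)) * \<phi> (Suc n) x
          + (a n * E0 (q ^ n)) * \<phi> n x + (a n * Em (q ^ n)) * \<phi> (n - 1) x"
      unfolding \<phi>[OF x] by (simp only: P_def N_def y_def distrib_left mult.assoc)
  next
    show "a 0 * Em (q ^ 0) = 0" by (simp add: Em_def)
  next
    fix m
    define N where "N = q ^ m"
    have N: "N \<noteq> 0" using nz by (simp add: N_def)
    define G where "G = (- q * B / s) ^ m / q ^ (m * m) * qpoch s q m"
    define z where "z = b * B / (s * B' * q)"
    have r1: "h (Suc m) * (1 - q * N) * (1 - b * N)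
        = h m * ((1 + b / q) * N - b / q * (1 + q) * N\<^sup>2 - z) - b * N\<^sup>2 / q\<^sup>2 * shift h m"
      using rec[of m] by (simp add: N_def z_def)
    have r0: "h m * (1 - N) * (1 - b * N / q)
        = shift h m * ((1 + b / q) * N / q - b / q * (1 + q) * N\<^sup>2 / q\<^sup>2 - z)
          - b * N\<^sup>2 / q ^ 4 * shift (shift h) m"
    proof (cases m)
      case (Suc k)
      then show ?thesis using rec[of k] nz
        by (simp add: N_def z_def power_mult_distrib numeral_eq_Suc)
    qed (simp add: N_def)
    have a1: "a (Suc m) = - B / (s * N\<^sup>2) * (1 - s * N) * G * h (Suc m)"
      using nz nz' by (simp add: a_def G_def N_def power_add power2_eq_square power_mult_distrib field_simps)
    have a0: "a m = G * h m" by (simp add: a_def G_def)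
    \<comment> \<open>The factor \<open>1 - s * N / q\<close> completes the Pochhammer symbol of
      \<open>s\<close> from index m - 1 to m. It is not divided out, since it may be zero when the
      series terminates.\<close>
    have am: "shift a m * (1 - s * N / q) = - s * N\<^sup>2 / (q\<^sup>2 * B) * G * shift h m"
    proof (cases m)
      case (Suc k)
      then show ?thesis using nz nz'
        by (simp add: a_def G_def N_def power_add power2_eq_square power_mult_distrib field_simps)
    qed simp
    have amm: "shift (shift a) m * ((1 - s * N / q / q) * (1 - s * N / q))
        = s\<^sup>2 * N ^ 4 / (q ^ 6 * B\<^sup>2) * G * shift (shift h) m"
    proof (cases m)
      case m: (Suc k)
      show ?thesis
      proof (cases k)
        case (Suc l)
        then show ?thesis using nz nz' m
          by (simp add: a_def G_def N_def power_add numeral_eq_Suc power_mult_distrib field_simps)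
      qed (use m in simp)
    qed simp
    have "shift (shift a) m * E2 (N / q / q) + shift a m * E1 (N / q) + a m * E0 N + a (Suc m) * Em (q * N)
      = B * B' * q\<^sup>2 / (\<alpha> * N) * (shift (shift a) m * ((1 - s * N / q / q) * (1 - s * N / q)))
       + B' / \<alpha> * (s * q / b + s + q - (1 + q + q\<^sup>2) * s * N / q - B * q / (B' * N))
          * (shift a m * (1 - s * N / q)) + a m * E0 N + a (Suc m) * Em (q * N)"
      unfolding E2_def E1_def using nz nz' N by (simp add: mult_ac power2_eq_square)
    \<comment> \<open>Two consecutive instances of the three-term recurrence suffice; their weights
      are fixed by the coefficients of \<open>h (Suc m)\<close> and
      \<open>shift (shift h) m\<close>.\<close>
    also have "\<dots> = G * B' / (B * \<alpha>) * (
        - (s * q / b) * (1 - s * N) * (h (Suc m) * (1 - q * N) * (1 - b * N)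
           - (h m * ((1 + b / q) * N - b / q * (1 + q) * N\<^sup>2 - z) - b * N\<^sup>2 / q\<^sup>2 * shift h m))
        + N * s\<^sup>2 / b * (h m * (1 - N) * (1 - b * N / q)
           - (shift h m * ((1 + b / q) * N / q - b / q * (1 + q) * N\<^sup>2 / q\<^sup>2 - z)
              - b * N\<^sup>2 / q ^ 4 * shift (shift h) m)))"
      unfolding a0 a1 am amm E0_def Em_def z_def using nz nz' N
      by (simp add: divide_simps) (simp add: algebra_simps numeral_eq_Suc)
    also have "\<dots> = 0" unfolding r1 r0 by simp
    finally have "shift (shift a) m * E2 (N / q / q) + shift a m * E1 (N / q) + a m * E0 N
        + a (Suc m) * Em (q * N) = 0" .
    then show "shift (shift (\<lambda>n. a n * E2 (q ^ n))) m + shift (\<lambda>n. a n * E1 (q ^ n)) m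
        + a m * E0 (q ^ m) + a (Suc m) * Em (q ^ Suc m) = 0"
      unfolding shift_mult_power[OF nz(1)] shift_mult_power[OF nz(1), of _ "\<lambda>N. E2 (N / q)"]
      by (simp add: N_def)
  qed
qed

section \<open>Convolutions with the q-exponential series\<close>

unbundle fps_syntax

definition tri :: "nat \<Rightarrow> nat" where
  "tri n = n * (n - 1) div 2"

lemma tri_0 [simp]: "tri 0 = 0"
  by (simp add: tri_def)

lemma tri_double: "2 * tri n + n = n * n"
proof -
  have "even (n * (n - 1))" by (cases n) simp_all
  then have "2 * tri n = n * (n - 1)" unfolding tri_def by (rule dvd_mult_div_cancel)
  then show ?thesis by (cases n) simp_all
qed

lemma tri_Suc [simp]: "tri (Suc n) = tri n + n"
  using tri_double[of n] tri_double[of "Suc n"] by simp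

text \<open>Encoded as a composition, so that multiplicativity is inherited from composition of
  power series.\<close>

definition dilate :: "complex \<Rightarrow> complex fps \<Rightarrow> complex fps" where
  "dilate q f = fps_compose f (fps_const q * fps_X)"

lemma dilate_nth [simp]: "dilate q f $ n = q ^ n * f $ n"
  by (simp add: dilate_def fps_compose_linear)

lemma dilate_mult: "dilate q (f * g) = dilate q f * dilate q g"
  by (simp add: dilate_def fps_compose_mult_distrib)

text \<open>Euler's q-exponential: for |q| < 1 it expands the product of all
  \<open>1 + q^j w\<close> with j from 0 on.\<close>

definition qexp :: "complex \<Rightarrow> complex fps" where
  "qexp q = Abs_fps (\<lambda>j. q ^ tri j / qpoch q q j)"

text \<open>For |q| < 1 this splits off the first factor of the infinite product; comparing
  coefficients instead imposes no bound on |q|.\<close>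

lemma qexp_dilate:
  assumes nr: "\<forall>n::nat. n > 0 \<longrightarrow> q ^ n \<noteq> 1"
  shows "qexp q = (1 + fps_X) * dilate q (qexp q)"
proof (rule fps_ext)
  fix n
  show "qexp q $ n = ((1 + fps_X) * dilate q (qexp q)) $ n"
  proof (cases n)
    case (Suc j)
    have "qpoch q q j \<noteq> 0" "1 - q * q ^ j \<noteq> 0"
      using qpoch_self_nonzero[OF nr] nr[rule_format, of "Suc j"] by auto
    then show ?thesis
      by (simp add: Suc qexp_def distrib_right power_add divide_simps) (simp add: algebra_simps)
  qed (simp add: qexp_def distrib_right)
qed

text \<open>Moving the dilation from \<open>g\<close> to the whole product costs a factor
  \<open>1 + fps_X\<close>, hence two neighbouring coefficients. A q-difference equation for
  \<open>g\<close> thus becomes a recurrence for the coefficients of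
  \<open>qexp q * g\<close>.\<close>

lemma qexp_mult_dilate_nth:
  assumes nr: "\<forall>n::nat. n > 0 \<longrightarrow> q ^ n \<noteq> 1" and q: "q \<noteq> 0"
  shows "(qexp q * dilate q g) $ n
    = q ^ n * (qexp q * g) $ n + q ^ n / q * shift (fps_nth (qexp q * g)) n"
proof -
  have "qexp q * dilate q g = (1 + fps_X) * dilate q (qexp q * g)"
    by (subst qexp_dilate[OF nr]) (simp add: dilate_mult mult.assoc)
  then show ?thesis
    using q by (cases n) (simp_all add: distrib_right)
qed

text \<open>From one coefficient of \<open>G\<close> to the next the multiplier is
  \<open>z / ((1 - b q^k) (1 - q^(k+1)))\<close>. Powers \<open>q^n\<close> on coefficients are
  dilations and index shifts are multiplications by \<open>fps_X\<close>, so this is a second-order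
  q-difference equation for \<open>G\<close>, which is then multiplied by
  \<open>qexp q\<close>.\<close>

lemma qexp_convolution_recurrence_denominator:
  fixes b z :: complex
  assumes q: "q \<noteq> 0" and nr: "\<forall>n::nat. n > 0 \<longrightarrow> q ^ n \<noteq> 1" and b: "\<And>n. qpoch b q n \<noteq> 0"
  defines "h \<equiv> \<lambda>n. \<Sum>k\<le>n. z ^ k / (qpoch b q k * qpoch q q k) * (q ^ tri (n - k) / qpoch q q (n - k))"
  shows "h (Suc n) * (1 - q * q ^ n) * (1 - b * q ^ n)
        = h n * ((1 + b / q) * q ^ n - b / q * (1 + q) * (q ^ n)\<^sup>2 + z)
          - b * (q ^ n)\<^sup>2 / q\<^sup>2 * shift h n"
proof -
  define G where "G = Abs_fps (\<lambda>k. z ^ k / (qpoch b q k * qpoch q q k))"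
  define H where "H = qexp q * G"
  have h: "h = fps_nth H"
  proof
    fix n show "h n = H $ n"
      unfolding H_def by (subst mult.commute)
        (simp add: h_def fps_mult_nth G_def qexp_def atLeast0AtMost)
  qed
  have G: "G + fps_const (b / q) * dilate q (dilate q G)
      = fps_const (1 + b / q) * dilate q G + fps_const z * (fps_X * G)"
  proof (rule fps_ext)
    fix n
    show "(G + fps_const (b / q) * dilate q (dilate q G)) $ n
      = (fps_const (1 + b / q) * dilate q G + fps_const z * (fps_X * G)) $ n"
    proof (cases n)
      case (Suc k)
      have "qpoch q q k \<noteq> 0" "1 - q * q ^ k \<noteq> 0" "qpoch b q k \<noteq> 0" "1 - b * q ^ k \<noteq> 0"
        using qpoch_self_nonzero[OF nr] nr[rule_format, of "Suc k"] b[of k] b[of "Suc k"] by auto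
      moreover from this have "G $ Suc k * ((1 - q * q ^ k) * (1 - b * q ^ k)) = z * G $ k"
        by (simp add: G_def)
      ultimately show ?thesis
        using q by (simp add: Suc field_simps)
    qed (use q in \<open>simp add: field_simps\<close>)
  qed
  have "H + fps_const (b / q) * (qexp q * dilate q (dilate q G))
      = qexp q * (G + fps_const (b / q) * dilate q (dilate q G))"
    by (simp add: H_def algebra_simps)
  also have "\<dots> = fps_const (1 + b / q) * (qexp q * dilate q G) + fps_const z * (fps_X * H)"
    unfolding G by (simp add: H_def algebra_simps)
  finally have "(H + fps_const (b / q) * (qexp q * dilate q (dilate q G))) $ Suc n
    = (fps_const (1 + b / q) * (qexp q * dilate q G) + fps_const z * (fps_X * H)) $ Suc n"
    by (rule arg_cong)
  \<comment> \<open>The double dilation uses \<open>qexp_mult_dilate_nth\<close> twice, which brings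
    in the coefficient before n.\<close>
  then have "H $ Suc n + b / q * (q\<^sup>2 * (q ^ n)\<^sup>2 * H $ Suc n + (1 + q) * (q ^ n)\<^sup>2 * H $ n
        + (q ^ n)\<^sup>2 / q * shift (fps_nth H) n)
      - ((1 + b / q) * (q * q ^ n * H $ Suc n + q ^ n * H $ n) + z * H $ n) = 0" (is "?e = 0")
    using q by (simp add: qexp_mult_dilate_nth[OF nr q] H_def[symmetric] fps_mult_left_const_nth)
      (simp add: divide_simps, simp add: algebra_simps power2_eq_square)
  moreover have "h (Suc n) * (1 - q * q ^ n) * (1 - b * q ^ n)
      - (h n * ((1 + b / q) * q ^ n - b / q * (1 + q) * (q ^ n)\<^sup>2 + z)
          - b * (q ^ n)\<^sup>2 / q\<^sup>2 * shift h n) = ?e"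
    unfolding h using q by (simp add: field_simps power2_eq_square)
  ultimately show ?thesis by simp
qed

text \<open>Here the multiplier is \<open>z (1 - e q^k) / (q^(k+1) (1 - q^(k+1)))\<close>, which
  means \<open>G(q w) - G(q^2 w) = z w (G(w) - e G(q w))\<close>.\<close>

lemma qexp_convolution_recurrence_numerator:
  fixes e z :: complex
  assumes q: "q \<noteq> 0" and nr: "\<forall>n::nat. n > 0 \<longrightarrow> q ^ n \<noteq> 1"
  defines "h \<equiv> \<lambda>n. \<Sum>k\<le>n. qpoch e q k * z ^ k / (q ^ tri (Suc k) * qpoch q q k)
      * (q ^ tri (n - k) / qpoch q q (n - k))"
  shows "h (Suc n) * (1 - q * q ^ n) * (q * q ^ n)
        = h n * (z - z * e * q ^ n - q ^ n + (1 + q) * (q ^ n)\<^sup>2)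
          + shift h n * ((q ^ n)\<^sup>2 / q - z * e * q ^ n / q)"
proof -
  define G where "G = Abs_fps (\<lambda>k. qpoch e q k * z ^ k / (q ^ tri (Suc k) * qpoch q q k))"
  define H where "H = qexp q * G"
  have h: "h = fps_nth H"
  proof
    fix n show "h n = H $ n"
      unfolding H_def by (subst mult.commute)
        (simp add: h_def fps_mult_nth G_def qexp_def atLeast0AtMost)
  qed
  have G: "dilate q G + fps_const (z * e) * (fps_X * dilate q G)
      = dilate q (dilate q G) + fps_const z * (fps_X * G)"
  proof (rule fps_ext)
    fix n
    show "(dilate q G + fps_const (z * e) * (fps_X * dilate q G)) $ n
      = (dilate q (dilate q G) + fps_const z * (fps_X * G)) $ n"
    proof (cases n)
      case (Suc k)
      have "qpoch q q k \<noteq> 0" "1 - q * q ^ k \<noteq> 0"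
        using qpoch_self_nonzero[OF nr] nr[rule_format, of "Suc k"] by auto
      then have "G $ Suc k * ((1 - q * q ^ k) * (q * q ^ k)) = z * (1 - e * q ^ k) * G $ k"
        using q by (simp add: G_def power_add divide_simps)
      then show ?thesis by (simp add: Suc algebra_simps)
    qed simp
  qed
  have "qexp q * dilate q G + fps_const (z * e) * (fps_X * (qexp q * dilate q G))
      = qexp q * (dilate q G + fps_const (z * e) * (fps_X * dilate q G))"
    by (simp add: algebra_simps)
  also have "\<dots> = qexp q * dilate q (dilate q G) + fps_const z * (fps_X * H)"
    unfolding G by (simp add: H_def algebra_simps)
  finally have "(qexp q * dilate q G + fps_const (z * e) * (fps_X * (qexp q * dilate q G))) $ Suc n
    = (qexp q * dilate q (dilate q G) + fps_const z * (fps_X * H)) $ Suc n"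
    by (rule arg_cong)
  then have "q * q ^ n * H $ Suc n + q ^ n * H $ n
        + z * e * (q ^ n * H $ n + q ^ n / q * shift (fps_nth H) n)
      = q\<^sup>2 * (q ^ n)\<^sup>2 * H $ Suc n + (1 + q) * (q ^ n)\<^sup>2 * H $ n
        + (q ^ n)\<^sup>2 / q * shift (fps_nth H) n + z * H $ n"
    using q by (simp add: qexp_mult_dilate_nth[OF nr q] H_def[symmetric] fps_mult_left_const_nth)
      (simp add: field_simps power2_eq_square)
  then show ?thesis
    unfolding h using q by (simp add: field_simps power2_eq_square)
qed

text \<open>The rescaling turns the recurrence of the second convolution, with \<open>z e = q / b\<close>, into that
  of the first one, with \<open>z\<close> replaced by \<open>- b z / q\<close>.\<close>

lemma rescaled_convolution_recurrence:
  fixes b z :: complex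
  assumes q: "q \<noteq> 0" and b0: "b \<noteq> 0" and b: "\<And>n. qpoch b q n \<noteq> 0"
    and rec: "\<And>n. f (Suc n) * (1 - q * q ^ n) * (q * q ^ n)
        = f n * (z - q / b * q ^ n - q ^ n + (1 + q) * (q ^ n)\<^sup>2)
          + shift f n * ((q ^ n)\<^sup>2 / q - q / b * q ^ n / q)"
  defines "h \<equiv> \<lambda>n. q ^ tri n * (- b) ^ n / qpoch b q n * f n"
  shows "h (Suc n) * (1 - q * q ^ n) * (1 - b * q ^ n)
        = h n * ((1 + b / q) * q ^ n - b / q * (1 + q) * (q ^ n)\<^sup>2 - b * z / q)
          - b * (q ^ n)\<^sup>2 / q\<^sup>2 * shift h n"
proof -
  define N where "N = q ^ n"
  define c where "c = q ^ tri n * (- b) ^ n / qpoch b q n"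
  have N: "N \<noteq> 0" using q by (simp add: N_def)
  have bn: "1 - b * N \<noteq> 0" using b[of "Suc n"] by (simp add: N_def)
  have h0: "h n = c * f n" by (simp add: h_def c_def)
  have h1: "h (Suc n) * (1 - b * N) = - b * N * c * f (Suc n)"
    using bn by (simp add: h_def c_def N_def power_add)
  \<comment> \<open>\<open>shift h\<close> has one denominator factor fewer than \<open>c\<close>;
    bringing it over \<open>qpoch b q n\<close> produces \<open>1 - b * N / q\<close>.\<close>
  have hm: "b * N / q * shift h n = - c * (1 - b * N / q) * shift f n"
  proof (cases n)
    case (Suc k)
    then show ?thesis using q b[of "Suc k"]
      by (simp add: h_def c_def N_def power_add field_simps)
  qed simp
  have "h (Suc n) * (1 - q * N) * (1 - b * N) = (h (Suc n) * (1 - b * N)) * (1 - q * N)" by simp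
  also have "\<dots> = - b * c / q * (f (Suc n) * (1 - q * N) * (q * N))"
    unfolding h1 using q by simp
  also have "\<dots> = - b * c / q * (f n * (z - q / b * N - N + (1 + q) * N\<^sup>2)
       + shift f n * (N\<^sup>2 / q - q / b * N / q))"
    using rec[of n] by (simp add: N_def)
  \<comment> \<open>The constant \<open>q / b\<close> in \<open>rec\<close> matters here: it makes
    the coefficient of \<open>shift f n\<close> a multiple of \<open>1 - b * N / q\<close>, as
    \<open>hm\<close> needs.\<close>
  also have "\<dots> = c * f n * ((1 + b / q) * N - b / q * (1 + q) * N\<^sup>2 - b * z / q)
       - N / q * (- c * (1 - b * N / q) * shift f n)"
    using q b0 by (simp add: field_simps power2_eq_square)
  also have "\<dots> = h n * ((1 + b / q) * N - b / q * (1 + q) * N\<^sup>2 - b * z / q)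
       - b * N\<^sup>2 / q\<^sup>2 * shift h n"
    unfolding h0 hm[symmetric] by (simp add: power2_eq_square)
  finally show ?thesis by (simp add: N_def)
qed

section \<open>Matching the exponents in the summands\<close>

lemma theta_convolution_powers:
  fixes Q c d :: complex
  assumes "Q \<noteq> 0" "k \<le> n"
  shows "Q ^ (k * k) / (Q\<^sup>2) ^ (n * k) * (- c / Q) ^ k * (- d * Q) ^ n / Q ^ (n * n)
    = (- Q\<^sup>2 * d) ^ n / (Q\<^sup>2) ^ (n * n) * ((- c / Q\<^sup>2) ^ k * (Q\<^sup>2) ^ tri (n - k))"
proof -
  \<comment> \<open>The identity rests on completing the square in the exponent of \<open>Q\<close>:
    k^2 - 2nk - n^2 = (n-k)^2 - 2n^2. The linear parts turn (n-k)^2 into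
    \<open>2 * tri (n - k)\<close>.\<close>
  obtain j where n: "n = j + k" using \<open>k \<le> n\<close> by (metis le_Suc_ex add.commute)
  define T K M where "T = (Q\<^sup>2) ^ tri j" and "K = Q ^ (k * k)" and "M = Q ^ (j * k)"
  have T: "Q ^ (j * j) = Q ^ j * T"
    by (simp add: T_def power_mult[symmetric] power_add[symmetric] tri_double[symmetric, of j] add.commute)
  have e1: "(Q\<^sup>2) ^ (n * k) = (M * K)\<^sup>2"
    by (simp add: M_def K_def n power_mult[symmetric] power_add[symmetric] algebra_simps)
  have e2: "Q ^ (n * n) = Q ^ j * T * M\<^sup>2 * K"
    unfolding T[symmetric]
    by (simp add: M_def K_def n power_mult[symmetric] power_add[symmetric] algebra_simps mult_2_right)
  have e3: "(Q\<^sup>2) ^ (n * n) = (Q ^ j * T * M\<^sup>2 * K)\<^sup>2"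
    unfolding e2[symmetric] by (simp add: power_mult[symmetric] mult.commute)
  have e4: "(- c / Q) ^ k * (- d * Q) ^ n = (- 1) ^ k * c ^ k * (- 1) ^ n * d ^ n * Q ^ j"
    using assms(1) unfolding n power_minus[of "c / Q"] power_minus[of "d * Q"] minus_divide_left[symmetric] minus_mult_left[symmetric]
    by (simp add: power_mult_distrib power_divide power_add)
  have e5: "(- Q\<^sup>2 * d) ^ n * (- c / Q\<^sup>2) ^ k = (- 1) ^ k * c ^ k * (- 1) ^ n * d ^ n * (Q ^ j)\<^sup>2"
    using assms(1) unfolding n power_minus[of "c / Q\<^sup>2"] power_minus[of "Q\<^sup>2 * d"] minus_divide_left[symmetric] minus_mult_left[symmetric]
    by (simp add: power_mult_distrib power_divide power_add power_mult[symmetric] mult.commute[of 2])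
  have nz: "T \<noteq> 0" "K \<noteq> 0" "M \<noteq> 0" "Q ^ j \<noteq> 0" using assms by (simp_all add: T_def K_def M_def)
  have "Q ^ (k * k) / (Q\<^sup>2) ^ (n * k) * (- c / Q) ^ k * (- d * Q) ^ n / Q ^ (n * n)
     = K / (M * K)\<^sup>2 * ((- c / Q) ^ k * (- d * Q) ^ n) / (Q ^ j * T * M\<^sup>2 * K)"
    unfolding e1 e2 K_def by simp
  also have "\<dots> = ((- Q\<^sup>2 * d) ^ n * (- c / Q\<^sup>2) ^ k) * T / (Q ^ j * T * M\<^sup>2 * K)\<^sup>2"
    unfolding e4 e5 using nz assms(1) by (simp add: divide_simps power2_eq_square)
  also have "\<dots> = (- Q\<^sup>2 * d) ^ n / (Q\<^sup>2) ^ (n * n) * ((- c / Q\<^sup>2) ^ k * (Q\<^sup>2) ^ tri (n - k))"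
    unfolding e3 by (simp add: T_def n)
  finally show ?thesis .
qed

text \<open>Exposes the kernel \<open>q ^ tri (n - k)\<close> and the rescaling factor
  \<open>q ^ tri n * (- b) ^ n\<close>. It comes down to an identity of exponents, checked after
  doubling because \<open>tri_double\<close> describes only \<open>2 * tri\<close>.\<close>

lemma tri_convolution_powers:
  fixes q b d z :: complex
  assumes "q \<noteq> 0" "k \<le> n"
  shows "z ^ k / q ^ (n * k) * (b * d) ^ n
    = (- q * d) ^ n / q ^ (n * n) * (q ^ tri n * (- b) ^ n * (z ^ k / q ^ tri (Suc k) * q ^ tri (n - k)))"
proof -
  obtain j where n: "n = j + k" using \<open>k \<le> n\<close> by (metis le_Suc_ex add.commute)
  have "2 * (n * n + tri (Suc k)) = 2 * (n + tri n + tri (n - k) + n * k)"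
    using tri_double[of n] tri_double[of "Suc k"] tri_double[of j] by (simp add: n algebra_simps)
  then have "n * n + tri (Suc k) = n + tri n + tri (n - k) + n * k"
    by (rule nat_mult_eq_cancel1[THEN iffD1, rotated]) simp
  then have "q ^ (n * n) * q ^ tri (Suc k) = q ^ n * q ^ tri n * q ^ tri (n - k) * q ^ (n * k)"
    by (simp only: power_add[symmetric])
  then show ?thesis
    using assms by (simp add: power_mult_distrib power_minus[of b] power_minus[of "q * d"] divide_simps)
qed

lemma qpow_nat_exponents:
  "qpow lq (- of_nat n * of_nat k) = 1 / exp lq ^ (n * k)"
  "qpow lq (- of_nat n * of_nat k + of_nat k ^ 2 / 2) = qpow lq (1/2) ^ (k * k) / exp lq ^ (n * k)"
  "qpow lq (- (of_nat n ^ 2) / 2) = 1 / qpow lq (1/2) ^ (n * n)"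
proof -
  show 1: "qpow lq (- of_nat n * of_nat k) = 1 / exp lq ^ (n * k)" for n k
    using qpow_of_nat_mult[of lq "n * k" 1] qpow_minus[of lq "of_nat n * of_nat k"] by (simp add: qpow_one)
  have 2: "qpow lq (of_nat k ^ 2 / 2) = qpow lq (1/2) ^ (k * k)" for k
    using qpow_of_nat_mult[of lq "k * k" "1/2"] by (simp add: power2_eq_square)
  show "qpow lq (- of_nat n * of_nat k + of_nat k ^ 2 / 2) = qpow lq (1/2) ^ (k * k) / exp lq ^ (n * k)"
    unfolding qpow_add 1 2 by simp
  show "qpow lq (- (of_nat n ^ 2) / 2) = 1 / qpow lq (1/2) ^ (n * n)"
    using qpow_minus[of lq "of_nat n ^ 2 / 2"] by (simp add: 2)
qed

lemma qpoch_mult_inverse_power_eq_qfac: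
  assumes "x \<noteq> 0"
  shows "qpoch (x / B) q n * (1 / x) ^ n = qfac (1 / B) q n (1 / x)"
proof (induction n)
  case (Suc n)
  have "qpoch (x / B) q (Suc n) * (1 / x) ^ Suc n
     = (qpoch (x / B) q n * (1 / x) ^ n) * ((1 - x / B * q ^ n) * (1 / x))" by simp
  also have "(1 - x / B * q ^ n) * (1 / x) = 1 / x - 1 / B * q ^ n"
    using assms by (simp add: diff_divide_distrib)
  finally show ?case unfolding Suc.IH by simp
qed simp

section \<open>The three solutions\<close>

lemma formal_solution_2phi2:
  fixes q lq h1 l1 l2 \<alpha>1 lam t1 t2 :: complex
  assumes q0: "q \<noteq> 0" and nr: "\<forall>n::nat. n > 0 \<longrightarrow> q ^ n \<noteq> 1" and lq: "exp lq = q"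
    and t: "t1 \<noteq> 0" "t2 \<noteq> 0"
    and b1: "\<forall>n. qpoch (qpow lq (h1 - l1 + 1)) q n \<noteq> 0"
    and b2: "\<forall>n. qpoch (qpow lq (h1 - l2 + 1) * t1 / t2) q n \<noteq> 0"
  shows "formal_solution_poly lq (vconf_lhs lq h1 l1 l2 \<alpha>1 lam t1 t2) lam
          (\<lambda>n x. qpoch (qpow lq (h1 + 1/2) * t1 / x) q n * x ^ n)
          (\<lambda>n x. qpoch (qpow lq (h1 + 1/2) * t1 / x) q n
             * (qpoch (qpow lq (lam + \<alpha>1)) q n * q ^ (n * (n - 1) div 2)
                * (- qpow lq (- lam - \<alpha>1 - l1 - l2 + h1 + 3/2) * x / t2) ^ n
                / (qpoch (qpow lq (h1 - l1 + 1)) q n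
                   * qpoch (qpow lq (h1 - l2 + 1) * t1 / t2) q n * qpoch q q n)))"
  unfolding tri_def[symmetric] vconf_lhs_eq_vconf_op[OF t] lq
proof (rule formal_solution_polyI)
  define Q where "Q = qpow lq (1/2)"
  have Q0: "Q \<noteq> 0" by (simp add: Q_def)
  have qQ: "q = Q\<^sup>2" by (simp add: Q_def qpow_half_power2 lq)
  define A B1 B2 where "A = qpow lq (h1 + 1/2) * t1" and "B1 = qpow lq (l1 - 1/2) * t1"
    and "B2 = qpow lq (l2 - 1/2) * t2"
  define c1 c2 where "c1 = qpow lq (h1 - l1 + 1)" and "c2 = qpow lq (h1 - l2 + 1) * t1 / t2"
  define s where "s = qpow lq (lam + \<alpha>1)"
  define \<zeta> where "\<zeta> = - qpow lq (- lam - \<alpha>1 - l1 - l2 + h1 + 3/2) / t2"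
  define a where "a n = qpoch s q n * q ^ tri n * \<zeta> ^ n / (qpoch c1 q n * qpoch c2 q n * qpoch q q n)" for n
  have nz: "B1 \<noteq> 0" "B2 \<noteq> 0" "s \<noteq> 0" using t by (simp_all add: B1_def B2_def s_def)
  \<comment> \<open>In terms of the roots, the lower parameters are A / B1 and A / B2 and the
    argument is - A x / (s B1 B2); these values give the two-term recurrence required above.\<close>
  have c1': "c1 = A / B1"
    using t Q0 unfolding c1_def A_def B1_def qpow_simps lq Q_def[symmetric]
    by (simp add: qQ field_simps power2_eq_square)
  have c2': "c2 = A / B2"
    using t Q0 unfolding c2_def A_def B2_def qpow_simps lq Q_def[symmetric]
    by (simp add: qQ field_simps power2_eq_square)
  have \<zeta>': "\<zeta> = - A / (s * B1 * B2)"
    using t Q0 unfolding \<zeta>_def A_def s_def B1_def B2_def qpow_simps Q_def[symmetric]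
    by (simp add: field_simps power2_eq_square power3_eq_cube)
  show "q \<noteq> 0" "qpow lq (h1 + 1/2) * t1 \<noteq> 0" "qpow lq (l1 - 1/2) * t1 \<noteq> 0"
      "qpow lq (l2 - 1/2) * t2 \<noteq> 0" "qpow lq \<alpha>1 \<noteq> 0" "q = exp lq"
    using q0 t lq by simp_all
  show "qpoch (qpow lq (h1 + 1/2) * t1 / x) q n * x ^ n = qfac (qpow lq (h1 + 1/2) * t1) q n x"
    if "x \<noteq> 0" for n x
    using that by (rule qpoch_mult_power_eq_qfac)
  show "qpoch (qpow lq (h1 + 1/2) * t1 / x) q n
             * (qpoch (qpow lq (lam + \<alpha>1)) q n * q ^ tri n
                * (- qpow lq (- lam - \<alpha>1 - l1 - l2 + h1 + 3/2) * x / t2) ^ n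
                / (qpoch (qpow lq (h1 - l1 + 1)) q n
                   * qpoch (qpow lq (h1 - l2 + 1) * t1 / t2) q n * qpoch q q n))
      = a n * qfac (qpow lq (h1 + 1/2) * t1) q n x" if "x \<noteq> 0" for n x
  proof -
    have "- qpow lq (- lam - \<alpha>1 - l1 - l2 + h1 + 3/2) * x / t2 = \<zeta> * x" by (simp add: \<zeta>_def)
    then show ?thesis
      unfolding qpoch_mult_power_eq_qfac[OF that, symmetric] a_def c1_def c2_def s_def
      by (simp add: power_mult_distrib)
  qed
  show "a (Suc n) * (1 - q * q ^ n) * (qpow lq (l1 - 1/2) * t1 - qpow lq (h1 + 1/2) * t1 * q ^ n)
        * (qpow lq (l2 - 1/2) * t2 - qpow lq (h1 + 1/2) * t1 * q ^ n)
      = - (qpow lq (h1 + 1/2) * t1) * q ^ n * (1 / (qpow lq \<alpha>1 * qpow lq lam) - q ^ n) * a n" for n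
  proof -
    have f: "1 - c1 * q ^ n \<noteq> 0" "1 - c2 * q ^ n \<noteq> 0" "1 - q * q ^ n \<noteq> 0"
      using b1[rule_format, of "Suc n"] b2[rule_format, of "Suc n"] nr[rule_format, of "Suc n"]
      by (simp_all add: c1_def c2_def)
    have "B1 - A * q ^ n = B1 * (1 - c1 * q ^ n)" "B2 - A * q ^ n = B2 * (1 - c2 * q ^ n)"
      using nz by (simp_all add: c1' c2' field_simps)
    moreover have "a (Suc n) * (1 - q * q ^ n) * (B1 * (1 - c1 * q ^ n)) * (B2 * (1 - c2 * q ^ n))
        = B1 * B2 * \<zeta> * q ^ n * (1 - s * q ^ n) * a n"
      using f by (simp add: a_def power_add mult_ac)
    moreover have "B1 * B2 * \<zeta> * q ^ n * (1 - s * q ^ n) = - A * q ^ n * (1 / s - q ^ n)"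
      using nz by (simp add: \<zeta>' field_simps)
    moreover have "qpow lq \<alpha>1 * qpow lq lam = s" by (simp add: s_def qpow_add)
    ultimately show ?thesis unfolding A_def[symmetric] B1_def[symmetric] B2_def[symmetric] by simp
  qed
qed

text \<open>The lower parameter \<open>c\<close> is the ratio A / B1. Completing the square turns
  the base of the k-th power into \<open>- (c * B / (s * B' * q))\<close>, which is the constant
  term in the recurrence that \<open>formal_solution_inv_polyI\<close> requires.\<close>

lemma formal_solution_at_infinity_l1:
  fixes q lq h1 l1 l2 \<alpha>1 lam t1 t2 :: complex
  assumes q0: "q \<noteq> 0" and nr: "\<forall>n::nat. n > 0 \<longrightarrow> q ^ n \<noteq> 1" and lq: "exp lq = q"
    and t: "t1 \<noteq> 0" "t2 \<noteq> 0"
    and b: "\<forall>n. qpoch (qpow lq (h1 - l1 + 1)) q n \<noteq> 0"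
  shows "formal_solution_inv_poly lq (vconf_lhs lq h1 l1 l2 \<alpha>1 lam t1 t2) (- \<alpha>1)
          (\<lambda>n x. qpoch (x / (qpow lq (l1 - 1/2) * t1)) q n * (1 / x) ^ n)
          (\<lambda>n x. (\<Sum>k\<le>n. qpow lq (- of_nat n * of_nat k + of_nat k ^ 2 / 2)
                     * (1 / (qpoch (qpow lq (h1 - l1 + 1)) q k * qpoch q q (n - k) * qpoch q q k))
                     * (- qpow lq (- lam - \<alpha>1 + h1 + 1/2) * t1 / (qpow lq l2 * t2)) ^ k)
             * qpoch (x / (qpow lq (l1 - 1/2) * t1)) q n
             * (- qpow lq (- lam - \<alpha>1 + l1) * t1 / x) ^ n
             * qpoch (qpow lq (lam + \<alpha>1)) q n
             * qpow lq (- (of_nat n ^ 2) / 2))"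
proof -
  define Q where "Q = qpow lq (1/2)"
  have Q0: "Q \<noteq> 0" by (simp add: Q_def)
  have qQ: "q = Q\<^sup>2" by (simp add: Q_def qpow_half_power2 lq)
  define B B' where "B = qpow lq (l1 - 1/2) * t1" and "B' = qpow lq (l2 - 1/2) * t2"
  define c where "c = qpow lq (h1 - l1 + 1)"
  define s where "s = qpow lq (lam + \<alpha>1)"
  have nz: "B \<noteq> 0" "B' \<noteq> 0" "c \<noteq> 0" "s \<noteq> 0" using t by (simp_all add: B_def B'_def c_def s_def)
  have cB: "qpow lq (h1 + 1/2) * t1 = c * B"
    using Q0 unfolding c_def B_def qpow_simps lq Q_def[symmetric]
    by (simp add: qQ field_simps power2_eq_square)
  have z: "- qpow lq (- lam - \<alpha>1 + h1 + 1/2) * t1 / (qpow lq l2 * t2) = - (c * B / (s * B')) / Q"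
    using t Q0 unfolding cB[symmetric] s_def B'_def qpow_simps Q_def[symmetric]
    by (simp add: field_simps)
  have d: "- qpow lq (- lam - \<alpha>1 + l1) * t1 / x = - (B / s) * Q * (1 / x)" for x
    using t Q0 unfolding s_def B_def qpow_simps Q_def[symmetric] by (simp add: field_simps)
  define h where "h n = (\<Sum>k\<le>n. (- (c * B / (s * B' * q))) ^ k / (qpoch c q k * qpoch q q k)
      * (q ^ tri (n - k) / qpoch q q (n - k)))" for n
  show ?thesis
    unfolding vconf_lhs_eq_vconf_op[OF t] lq cB unfolding B_def[symmetric] B'_def[symmetric]
  proof (rule formal_solution_inv_polyI)
    show "q \<noteq> 0" "c \<noteq> 0" "B \<noteq> 0" "B' \<noteq> 0" "q = exp lq" "s = qpow lq (lam + \<alpha>1)"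
      using q0 nz lq by (simp_all add: s_def)
    show "qpoch (x / B) q n * (1 / x) ^ n = qfac (1 / B) q n (1 / x)" if "x \<noteq> 0" for n x
      using that by (rule qpoch_mult_inverse_power_eq_qfac)
    show "h (Suc n) * (1 - q * q ^ n) * (1 - c * q ^ n)
        = h n * ((1 + c / q) * q ^ n - c / q * (1 + q) * (q ^ n)\<^sup>2 - c * B / (s * B' * q))
          - c * (q ^ n)\<^sup>2 / q\<^sup>2 * shift h n" for n
      using qexp_convolution_recurrence_denominator[OF q0 nr, of c "- (c * B / (s * B' * q))" n] b
      unfolding h_def c_def by simp
    show "(\<Sum>k\<le>n. qpow lq (- of_nat n * of_nat k + of_nat k ^ 2 / 2)
            * (1 / (qpoch (qpow lq (h1 - l1 + 1)) q k * qpoch q q (n - k) * qpoch q q k))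
            * (- qpow lq (- lam - \<alpha>1 + h1 + 1/2) * t1 / (qpow lq l2 * t2)) ^ k)
          * qpoch (x / B) q n
          * (- qpow lq (- lam - \<alpha>1 + l1) * t1 / x) ^ n
          * qpoch (qpow lq (lam + \<alpha>1)) q n
          * qpow lq (- (of_nat n ^ 2) / 2)
        = (- q * B / s) ^ n / q ^ (n * n) * qpoch s q n * h n * qfac (1 / B) q n (1 / x)"
      if "x \<noteq> 0" for n x
    proof -
      have "(\<Sum>k\<le>n. Q ^ (k * k) / q ^ (n * k) * (1 / (qpoch c q k * qpoch q q (n - k) * qpoch q q k))
            * (- (c * B / (s * B')) / Q) ^ k) * (- (B / s) * Q) ^ n / Q ^ (n * n)
          = (- q * B / s) ^ n / q ^ (n * n) * h n"
        unfolding h_def sum_distrib_left sum_distrib_right sum_divide_distrib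
      proof (rule sum.cong[OF refl])
        fix k assume k: "k \<in> {..n}"
        \<comment> \<open>Separates the Pochhammer factors from the powers, so that only exponents
          remain to be compared.\<close>
        have frac: "K * (1 / (u * v * w)) * P * D / M = R * (Z / (u * w) * (T / v))"
          if "K * P * D / M = R * (Z * T)" for K P D M R Z T u v w :: complex
        proof -
          have "K * (1 / (u * v * w)) * P * D / M = K * P * D / M / (u * v * w)" by simp
          also have "\<dots> = R * (Z / (u * w) * (T / v))" unfolding that by (simp add: mult_ac)
          finally show ?thesis .
        qed
        have "Q ^ (k * k) / q ^ (n * k) * (- (c * B / (s * B')) / Q) ^ k * (- (B / s) * Q) ^ n / Q ^ (n * n)
          = (- q * (B / s)) ^ n / q ^ (n * n) * ((- (c * B / (s * B')) / q) ^ k * q ^ tri (n - k))"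
          unfolding qQ using k by (intro theta_convolution_powers Q0) simp
        moreover have "- (c * B / (s * B')) / q = - (c * B / (s * B' * q))" "- q * (B / s) = - q * B / s"
          by simp_all
        ultimately show "Q ^ (k * k) / q ^ (n * k) * (1 / (qpoch c q k * qpoch q q (n - k) * qpoch q q k))
            * (- (c * B / (s * B')) / Q) ^ k * (- (B / s) * Q) ^ n / Q ^ (n * n)
          = (- q * B / s) ^ n / q ^ (n * n) * ((- (c * B / (s * B' * q))) ^ k / (qpoch c q k * qpoch q q k)
              * (q ^ tri (n - k) / qpoch q q (n - k)))"
          by (intro frac) (simp only:)
      qed
      then have "(\<Sum>k\<le>n. Q ^ (k * k) / q ^ (n * k) * (1 / (qpoch c q k * qpoch q q (n - k) * qpoch q q k))
            * (- (c * B / (s * B')) / Q) ^ k) * (- (B / s) * Q) ^ n / Q ^ (n * n)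
            * (qpoch s q n * (qpoch (x / B) q n * (1 / x) ^ n))
          = (- q * B / s) ^ n / q ^ (n * n) * h n * (qpoch s q n * (qpoch (x / B) q n * (1 / x) ^ n))"
        by (rule arg_cong)
      then show ?thesis
        unfolding qpow_nat_exponents lq Q_def[symmetric] c_def[symmetric] s_def[symmetric] z d
          qpoch_mult_inverse_power_eq_qfac[OF that, symmetric] power_mult_distrib[of _ "1 / x"]
        by (simp only: mult_ac times_divide_eq_left times_divide_eq_right mult_1_left)
    qed
  qed
qed

text \<open>The sum itself satisfies a different recurrence; the denominator
  \<open>qpoch c q n\<close> in front of it, together with \<open>q ^ tri n * (- c) ^ n\<close>, is
  the rescaling that converts it to the required one.\<close>

lemma formal_solution_at_infinity_l2:
  fixes q lq h1 l1 l2 \<alpha>1 lam t1 t2 :: complex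
  assumes q0: "q \<noteq> 0" and nr: "\<forall>n::nat. n > 0 \<longrightarrow> q ^ n \<noteq> 1" and lq: "exp lq = q"
    and t: "t1 \<noteq> 0" "t2 \<noteq> 0"
    and b: "\<forall>n. qpoch (qpow lq (1 + h1 - l2) * t1 / t2) q n \<noteq> 0"
  shows "formal_solution_inv_poly lq (vconf_lhs lq h1 l1 l2 \<alpha>1 lam t1 t2) (- \<alpha>1)
          (\<lambda>n x. qpoch (x / (qpow lq (l2 - 1/2) * t2)) q n * (1 / x) ^ n)
          (\<lambda>n x. (\<Sum>k\<le>n. qpow lq (- of_nat n * of_nat k)
                     * (qpoch (qpow lq (lam + \<alpha>1 - h1 + l1)) q k
                        / (qpoch q q (n - k) * qpoch q q k))
                     * (qpow lq (- lam - \<alpha>1 + l2) * t2 / (qpow lq l1 * t1)) ^ k)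
             * qpoch (x / (qpow lq (l2 - 1/2) * t2)) q n
             * (qpow lq (- lam - \<alpha>1 + h1 + 1/2) * t1 / x) ^ n
             * (qpoch (qpow lq (lam + \<alpha>1)) q n / qpoch (qpow lq (1 + h1 - l2) * t1 / t2) q n))"
proof -
  define Q where "Q = qpow lq (1/2)"
  have Q0: "Q \<noteq> 0" by (simp add: Q_def)
  have qQ: "q = Q\<^sup>2" by (simp add: Q_def qpow_half_power2 lq)
  define B B' where "B = qpow lq (l2 - 1/2) * t2" and "B' = qpow lq (l1 - 1/2) * t1"
  define c where "c = qpow lq (1 + h1 - l2) * t1 / t2"
  define s where "s = qpow lq (lam + \<alpha>1)"
  define e where "e = qpow lq (lam + \<alpha>1 - h1 + l1)"
  define z where "z = qpow lq (- lam - \<alpha>1 + l2) * t2 / (qpow lq l1 * t1)"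
  have nz: "B \<noteq> 0" "B' \<noteq> 0" "c \<noteq> 0" "s \<noteq> 0" using t by (simp_all add: B_def B'_def c_def s_def)
  have cB: "qpow lq (h1 + 1/2) * t1 = c * B"
    using Q0 t unfolding c_def B_def qpow_simps lq Q_def[symmetric]
    by (simp add: qQ field_simps power2_eq_square)
  have z': "z = B / (s * B')"
    using t Q0 unfolding z_def s_def B_def B'_def qpow_simps Q_def[symmetric]
    by (simp add: field_simps)
  \<comment> \<open>This relation between the base and the numerator parameter is the one under
    which the rescaling works.\<close>
  have ze: "z * e = q / c"
    using t q0 unfolding z_def e_def c_def qpow_simps lq by (simp add: field_simps)
  have d: "qpow lq (- lam - \<alpha>1 + h1 + 1/2) * t1 / x = c * (B / s) * (1 / x)" for x
    using cB unfolding s_def qpow_simps by (simp add: field_simps)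
  define f where "f n = (\<Sum>k\<le>n. qpoch e q k * z ^ k / (q ^ tri (Suc k) * qpoch q q k)
      * (q ^ tri (n - k) / qpoch q q (n - k)))" for n
  define h where "h n = q ^ tri n * (- c) ^ n / qpoch c q n * f n" for n
  show ?thesis
    unfolding vconf_lhs_eq_vconf_op[OF t] lq cB unfolding B_def[symmetric] B'_def[symmetric]
      vconf_op_commute[of q _ B']
  proof (rule formal_solution_inv_polyI)
    show "q \<noteq> 0" "c \<noteq> 0" "B \<noteq> 0" "B' \<noteq> 0" "q = exp lq" "s = qpow lq (lam + \<alpha>1)"
      using q0 nz lq by (simp_all add: s_def)
    show "qpoch (x / B) q n * (1 / x) ^ n = qfac (1 / B) q n (1 / x)" if "x \<noteq> 0" for n x
      using that by (rule qpoch_mult_inverse_power_eq_qfac)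
    have "f (Suc n) * (1 - q * q ^ n) * (q * q ^ n)
        = f n * (z - q / c * q ^ n - q ^ n + (1 + q) * (q ^ n)\<^sup>2)
          + shift f n * ((q ^ n)\<^sup>2 / q - q / c * q ^ n / q)" for n
      using qexp_convolution_recurrence_numerator[OF q0 nr, of e z n] unfolding f_def ze .
    moreover have "\<And>n. qpoch c q n \<noteq> 0" using b by (simp add: c_def)
    ultimately have "h (Suc n) * (1 - q * q ^ n) * (1 - c * q ^ n)
        = h n * ((1 + c / q) * q ^ n - c / q * (1 + q) * (q ^ n)\<^sup>2 - c * z / q)
          - c * (q ^ n)\<^sup>2 / q\<^sup>2 * shift h n" for n
      unfolding h_def by (intro rescaled_convolution_recurrence q0 nz)
    then show "h (Suc n) * (1 - q * q ^ n) * (1 - c * q ^ n)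
        = h n * ((1 + c / q) * q ^ n - c / q * (1 + q) * (q ^ n)\<^sup>2 - c * B / (s * B' * q))
          - c * (q ^ n)\<^sup>2 / q\<^sup>2 * shift h n" for n
      by (simp add: z')
    show "(\<Sum>k\<le>n. qpow lq (- of_nat n * of_nat k)
            * (qpoch (qpow lq (lam + \<alpha>1 - h1 + l1)) q k / (qpoch q q (n - k) * qpoch q q k))
            * (qpow lq (- lam - \<alpha>1 + l2) * t2 / (qpow lq l1 * t1)) ^ k)
          * qpoch (x / B) q n
          * (qpow lq (- lam - \<alpha>1 + h1 + 1/2) * t1 / x) ^ n
          * (qpoch (qpow lq (lam + \<alpha>1)) q n / qpoch (qpow lq (1 + h1 - l2) * t1 / t2) q n)
        = (- q * B / s) ^ n / q ^ (n * n) * qpoch s q n * h n * qfac (1 / B) q n (1 / x)"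
      if "x \<noteq> 0" for n x
    proof -
      have "(\<Sum>k\<le>n. 1 / q ^ (n * k) * (qpoch e q k / (qpoch q q (n - k) * qpoch q q k)) * z ^ k)
            * (c * (B / s)) ^ n
          = (- q * B / s) ^ n / q ^ (n * n) * (q ^ tri n * (- c) ^ n * f n)"
        unfolding f_def sum_distrib_left sum_distrib_right
      proof (rule sum.cong[OF refl])
        fix k assume "k \<in> {..n}"
        then have "z ^ k / q ^ (n * k) * (c * (B / s)) ^ n
          = (- q * (B / s)) ^ n / q ^ (n * n)
            * (q ^ tri n * (- c) ^ n * (z ^ k / q ^ tri (Suc k) * q ^ tri (n - k)))"
          by (intro tri_convolution_powers q0) simp
        moreover have "- q * (B / s) = - q * B / s" by simp
        ultimately have "(z ^ k / q ^ (n * k) * (c * (B / s)) ^ n) * (qpoch e q k / (qpoch q q (n - k) * qpoch q q k))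
          = ((- q * B / s) ^ n / q ^ (n * n)
            * (q ^ tri n * (- c) ^ n * (z ^ k / q ^ tri (Suc k) * q ^ tri (n - k))))
            * (qpoch e q k / (qpoch q q (n - k) * qpoch q q k))" by (simp only:)
        then show "1 / q ^ (n * k) * (qpoch e q k / (qpoch q q (n - k) * qpoch q q k)) * z ^ k * (c * (B / s)) ^ n
          = (- q * B / s) ^ n / q ^ (n * n) * (q ^ tri n * (- c) ^ n
            * (qpoch e q k * z ^ k / (q ^ tri (Suc k) * qpoch q q k) * (q ^ tri (n - k) / qpoch q q (n - k))))"
          by (simp add: mult_ac)
      qed
      then have "(\<Sum>k\<le>n. 1 / q ^ (n * k) * (qpoch e q k / (qpoch q q (n - k) * qpoch q q k)) * z ^ k)
            * (c * (B / s)) ^ n * (qpoch s q n / qpoch c q n * (qpoch (x / B) q n * (1 / x) ^ n))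
          = (- q * B / s) ^ n / q ^ (n * n) * (q ^ tri n * (- c) ^ n * f n)
            * (qpoch s q n / qpoch c q n * (qpoch (x / B) q n * (1 / x) ^ n))"
        by (rule arg_cong)
      then show ?thesis
        unfolding qpow_nat_exponents lq c_def[symmetric] s_def[symmetric] e_def[symmetric]
          z_def[symmetric] d h_def
          qpoch_mult_inverse_power_eq_qfac[OF that, symmetric] power_mult_distrib[of _ "1 / x"]
        by (simp add: mult_ac)
    qed
  qed
qed

theorem theorem5p2:
  fixes q lq h1 l1 l2 \<alpha>1 lam t1 t2 :: complex
  assumes q_nonzero: "q \<noteq> 0"
    and q_not_root_of_unity: "\<forall>n::nat. n > 0 \<longrightarrow> q ^ n \<noteq> 1"
    and log_q: "exp lq = q"
    and t1: "t1 \<noteq> 0" and t2: "t2 \<noteq> 0"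
  shows
    "((\<forall>n. qpoch (qpow lq (h1 - l1 + 1)) q n \<noteq> 0) \<longrightarrow>
      (\<forall>n. qpoch (qpow lq (h1 - l2 + 1) * t1 / t2) q n \<noteq> 0) \<longrightarrow>
        formal_solution_poly lq (vconf_lhs lq h1 l1 l2 \<alpha>1 lam t1 t2) lam
          (\<lambda>n x. qpoch (qpow lq (h1 + 1/2) * t1 / x) q n * x ^ n)
          (\<lambda>n x. qpoch (qpow lq (h1 + 1/2) * t1 / x) q n
             * (qpoch (qpow lq (lam + \<alpha>1)) q n * q ^ (n * (n - 1) div 2)
                * (- qpow lq (- lam - \<alpha>1 - l1 - l2 + h1 + 3/2) * x / t2) ^ n
                / (qpoch (qpow lq (h1 - l1 + 1)) q n
                   * qpoch (qpow lq (h1 - l2 + 1) * t1 / t2) q n * qpoch q q n)))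
        \<and> (\<forall>n x. x \<noteq> 0 \<longrightarrow>
             qpoch (qpow lq (h1 + 1/2) * t1 / x) q n
             * (qpoch (qpow lq (lam + \<alpha>1)) q n * q ^ (n * (n - 1) div 2)
                * (- qpow lq (- lam - \<alpha>1 - l1 - l2 + h1 + 3/2) * x / t2) ^ n
                / (qpoch (qpow lq (h1 - l1 + 1)) q n
                   * qpoch (qpow lq (h1 - l2 + 1) * t1 / t2) q n * qpoch q q n))
             = basic_hypergeom_term
                 [qpow lq (lam + \<alpha>1), qpow lq (h1 + 1/2) * t1 / x]
                 [qpow lq (h1 - l1 + 1), qpow lq (h1 - l2 + 1) * t1 / t2]
                 q (qpow lq (- lam - \<alpha>1 - l1 - l2 + h1 + 3/2) * x / t2) n))
     \<and>
     ((\<forall>n. qpoch (qpow lq (h1 - l1 + 1)) q n \<noteq> 0) \<longrightarrow>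
        formal_solution_inv_poly lq (vconf_lhs lq h1 l1 l2 \<alpha>1 lam t1 t2) (- \<alpha>1)
          (\<lambda>n x. qpoch (x / (qpow lq (l1 - 1/2) * t1)) q n * (1 / x) ^ n)
          (\<lambda>n x. (\<Sum>k\<le>n. qpow lq (- of_nat n * of_nat k + of_nat k ^ 2 / 2)
                     * (1 / (qpoch (qpow lq (h1 - l1 + 1)) q k * qpoch q q (n - k) * qpoch q q k))
                     * (- qpow lq (- lam - \<alpha>1 + h1 + 1/2) * t1 / (qpow lq l2 * t2)) ^ k)
             * qpoch (x / (qpow lq (l1 - 1/2) * t1)) q n
             * (- qpow lq (- lam - \<alpha>1 + l1) * t1 / x) ^ n
             * qpoch (qpow lq (lam + \<alpha>1)) q n
             * qpow lq (- (of_nat n ^ 2) / 2)))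
     \<and>
     ((\<forall>n. qpoch (qpow lq (1 + h1 - l2) * t1 / t2) q n \<noteq> 0) \<longrightarrow>
        formal_solution_inv_poly lq (vconf_lhs lq h1 l1 l2 \<alpha>1 lam t1 t2) (- \<alpha>1)
          (\<lambda>n x. qpoch (x / (qpow lq (l2 - 1/2) * t2)) q n * (1 / x) ^ n)
          (\<lambda>n x. (\<Sum>k\<le>n. qpow lq (- of_nat n * of_nat k)
                     * (qpoch (qpow lq (lam + \<alpha>1 - h1 + l1)) q k
                        / (qpoch q q (n - k) * qpoch q q k))
                     * (qpow lq (- lam - \<alpha>1 + l2) * t2 / (qpow lq l1 * t1)) ^ k)
             * qpoch (x / (qpow lq (l2 - 1/2) * t2)) q n
             * (qpow lq (- lam - \<alpha>1 + h1 + 1/2) * t1 / x) ^ n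
             * (qpoch (qpow lq (lam + \<alpha>1)) q n / qpoch (qpow lq (1 + h1 - l2) * t1 / t2) q n)))"
proof -
  \<comment> \<open>With two upper and two lower parameters the bracket in the series has exponent
    1, so its \<open>(-1) ^ n\<close> accounts for the minus sign of the argument.\<close>
  have hyp: "qpoch A q n * (S * T * (- c * x / t) ^ n / (U * V * W))
    = basic_hypergeom_term [a, A] [b, b'] q (c * x / t) n"
    if "S = qpoch a q n" "T = q ^ (n * (n - 1) div 2)" "U = qpoch b q n" "V = qpoch b' q n" "W = qpoch q q n"
    for A S T U V W a b b' c t x :: complex and n
    unfolding that basic_hypergeom_term_def using power_minus[of "c * x / t" n] by simp
  show ?thesis
    using formal_solution_2phi2[OF q_nonzero q_not_root_of_unity log_q t1 t2]
      formal_solution_at_infinity_l1[OF q_nonzero q_not_root_of_unity log_q t1 t2]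
      formal_solution_at_infinity_l2[OF q_nonzero q_not_root_of_unity log_q t1 t2]
    by (intro conjI impI allI hyp refl) blast+
qed

end
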